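(* Let $\mathcal{L} \subset \mathbb{P}^{2}_{\mathbb{C}}$ be the arrangement of the $28$ bitangents associated with a smooth plane quartic $C$. Then the number $n_{4}$ of quadruple points of $\mathcal{L}$ is bounded from above by $44$.
   Context: A bitangent of a smooth plane quartic is a line tangent to the curve at two points, which are allowed to coincide, i.e. the line cuts out a divisor $2P+2P'$ on the curve, with $P=P'$ allowed; a smooth complex plane quartic has exactly $28$ bitangents in this sense. A quadruple point of a line arrangement is a point lying on exactly four of the lines. *)

theory Defs
  imports "HOL-Analysis.Analysis" "HOL-Library.Poly_Mapping" "HOL-Library.Multiset"
    "HOL-Computational_Algebra.Polynomial"
begin

(* Polynomials over the complex numbers in three variables, indexed by the three-element type 3;
   the exponent of a monomial m at the variable i is lookup m i. *)
type_synonym ternary_poly = "(3 \<Rightarrow>\<^sub>0 nat) \<Rightarrow>\<^sub>0 complex"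

definition homogeneous :: "nat \<Rightarrow> ternary_poly \<Rightarrow> bool" where
  "homogeneous d F \<longleftrightarrow>
     (\<forall>m\<in>Poly_Mapping.keys F. (\<Sum>i\<in>UNIV. Poly_Mapping.lookup m i) = d)"

definition eval_at :: "ternary_poly \<Rightarrow> complex ^ 3 \<Rightarrow> complex" where
  "eval_at F v =
     (\<Sum>m\<in>Poly_Mapping.keys F. Poly_Mapping.lookup F m *
        (\<Prod>i\<in>UNIV. (v $ i) ^ Poly_Mapping.lookup m i))"

(* For exponent 0 the factor of_nat 0 makes the truncated subtraction harmless. *)
definition partial_at :: "3 \<Rightarrow> ternary_poly \<Rightarrow> complex ^ 3 \<Rightarrow> complex" where
  "partial_at i F v =
     (\<Sum>m\<in>Poly_Mapping.keys F. Poly_Mapping.lookup F m *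
        (of_nat (Poly_Mapping.lookup m i) * (v $ i) ^ (Poly_Mapping.lookup m i - 1) *
         (\<Prod>j\<in>UNIV - {i}. (v $ j) ^ Poly_Mapping.lookup m j)))"

(* The curve is represented by its equation F. The zero polynomial is excluded, since every
   vector would violate the Jacobian condition. *)
definition smooth_plane_quartic :: "ternary_poly \<Rightarrow> bool" where
  "smooth_plane_quartic F \<longleftrightarrow> homogeneous 4 F \<and>
     (\<forall>v. v \<noteq> 0 \<longrightarrow> eval_at F v = 0 \<longrightarrow> (\<exists>i. partial_at i F v \<noteq> 0))"

(* Points and lines of the complex projective plane are the complex linear subspaces of
   complex ^ 3 of dimension 1 and 2; the point P lies on the line l iff P is a subset of l.
   The prefix vec selects linear algebra over the complex scalars (not over the reals). *)
definition proj_points :: "(complex ^ 3) set set" where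
  "proj_points = {P. vec.subspace P \<and> vec.dim P = 1}"

definition proj_lines :: "(complex ^ 3) set set" where
  "proj_lines = {l. vec.subspace l \<and> vec.dim l = 2}"

(* The univariate polynomial F(p + T q). Its order of vanishing at T = 0 is the intersection
   multiplicity, at the point spanned by p, of the curve F = 0 with the line spanned by p and q. *)
definition restrict_to_line :: "ternary_poly \<Rightarrow> complex ^ 3 \<Rightarrow> complex ^ 3 \<Rightarrow> complex poly" where
  "restrict_to_line F p q =
     (\<Sum>m\<in>Poly_Mapping.keys F. Polynomial.smult (Poly_Mapping.lookup F m)
        (\<Prod>i\<in>UNIV. [:p $ i, q $ i:] ^ Poly_Mapping.lookup m i))"

(* The line l is not a component of the curve F = 0 and cuts out the effective divisor D on it.
   Every point of l occurs as the span of p for some basis p, q of l, and for homogeneous F the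
   order depends only on l and that span. Nonvanishing is required because the order of the
   zero polynomial is a junk value. *)
definition cuts_out_divisor ::
    "ternary_poly \<Rightarrow> (complex ^ 3) set \<Rightarrow> (complex ^ 3) set multiset \<Rightarrow> bool" where
  "cuts_out_divisor F l D \<longleftrightarrow>
     (\<forall>P\<in>set_mset D. P \<in> proj_points \<and> P \<subseteq> l) \<and>
     (\<forall>p q. vec.span {p, q} = l \<longrightarrow>
        restrict_to_line F p q \<noteq> 0 \<and>
        Polynomial.order 0 (restrict_to_line F p q) = count D (vec.span {p}))"

definition bitangents :: "ternary_poly \<Rightarrow> (complex ^ 3) set set" where
  "bitangents F = {l \<in> proj_lines. \<exists>P P'. cuts_out_divisor F l {#P, P, P', P'#}}"

definition quadruple_points :: "(complex ^ 3) set set \<Rightarrow> (complex ^ 3) set set" where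
  "quadruple_points L = {P \<in> proj_points. card {l \<in> L. P \<subseteq> l} = 4}"

end

theory Submission
  imports Defs
begin

text \<open>
  Let \<open>p\<close> be a point on four bitangents. It does not lie on the curve, and after a linear change of
  coordinates the equation reads \<open>k x\<^sup>4 + Q(y, z) x\<^sup>2 + C(y, z) x + R(y, z)\<close> with \<open>p = (1, 0, 0)\<close>. A line
  through \<open>p\<close> is a bitangent iff on it \<open>C\<close> and \<open>D = Q\<^sup>2 - 4 k R\<close> vanish. The cubic \<open>C\<close> has four zeros, so
  \<open>C = 0\<close> and \<open>x \<mapsto> - x\<close> preserves the curve.

  A bitangent contains at most three such centres: the reflections permute its points of contact,
  and comparing the equation at these points and their images leaves only three possibilities.

  The existence of one centre \<open>p\<close> bounds the number of bitangents. A bitangent missing \<open>p\<close> is the graph of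
  a linear form \<open>x\<close> on the plane of \<open>y\<close> and \<open>z\<close>, and turns \<open>D\<close>, which has four distinct zeros, into a product of two
  quadratic forms with sum \<open>4 k x\<^sup>2 + 2 Q\<close>. There are three ways to distribute the zeros, in each
  case the scaling of the factors is a root of a quartic polynomial, and then the squares of two
  values of \<open>x\<close> are known. This gives at most \<open>3 * 4 * 4 = 48\<close> lines, hence at most \<open>52\<close> bitangents, and at
  most \<open>52 * 3 / 4 = 39\<close> quadruple points.
\<close>

section \<open>Lines and independent pairs in three-space\<close>

text \<open>Formulated for the ordered pair: as a set, \<open>{u, w}\<close> collapses to a
  singleton when \<open>u = w\<close>, so set independence alone would not exclude that
  case.\<close>

definition indep2 :: "complex ^ 3 \<Rightarrow> complex ^ 3 \<Rightarrow> bool" where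
  "indep2 u w \<longleftrightarrow> (\<forall>x y. x *s u + y *s w = 0 \<longrightarrow> x = 0 \<and> y = 0)"

lemma indep2D: "indep2 u w \<Longrightarrow> x *s u + y *s w = 0 \<Longrightarrow> x = 0 \<and> y = 0"
  by (auto simp: indep2_def)

lemma indep2_sym: "indep2 u w \<Longrightarrow> indep2 w u"
  by (metis add.commute indep2_def)

lemma mem_span_pair:
  fixes a b :: "complex ^ 3"
  shows "v \<in> vec.span {a, b} \<longleftrightarrow> (\<exists>x y. v = x *s a + y *s b)"
  unfolding vec.span_insert vec.span_empty
  by (auto simp: algebra_simps)

lemma mem_span_single:
  fixes a :: "complex ^ 3"
  shows "v \<in> vec.span {a} \<longleftrightarrow> (\<exists>x. v = x *s a)"
  by (auto simp: vec.span_insert vec.span_empty)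

lemma indep2_iff:
  "indep2 u w \<longleftrightarrow> u \<noteq> w \<and> vec.independent {u, w}"
proof
  assume i: "indep2 u w"
  have "u \<noteq> w" using indep2D[OF i, of 1 "- 1"] by auto
  moreover have "u \<notin> vec.span {w}"
  proof
    assume "u \<in> vec.span {w}"
    then obtain x where "u = x *s w" by (auto simp: mem_span_single)
    then show False using indep2D[OF i, of 1 "- x"] by auto
  qed
  moreover have "w \<noteq> 0" using indep2D[OF i, of 0 1] by auto
  ultimately show "u \<noteq> w \<and> vec.independent {u, w}"
    by (simp add: vec.independent_insert)
next
  assume r: "u \<noteq> w \<and> vec.independent {u, w}"
  then have u: "u \<notin> vec.span {w}" and w: "w \<noteq> 0"
    by (auto simp: vec.independent_insert split: if_splits)
  show "indep2 u w" unfolding indep2_def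
  proof (intro allI impI)
    fix x y assume h: "x *s u + y *s w = 0"
    have "x = 0"
    proof (rule ccontr)
      assume x: "x \<noteq> 0"
      have "u = (1 / x) *s (x *s u + y *s w) + (- y / x) *s w"
        using x by (simp add: vec.scale_right_distrib vec.scale_scale flip: vec.scale_left_distrib)
      then have "u = (- y / x) *s w" using h by simp
      then show False using u unfolding mem_span_single by blast
    qed
    then show "x = 0 \<and> y = 0" using h w by auto
  qed
qed

lemma proj_line_eq_span:
  assumes l: "l \<in> proj_lines" and "u \<in> l" "w \<in> l" "indep2 u w"
  shows "l = vec.span {u, w}"
proof -
  have s: "vec.subspace l" "vec.dim l = 2" using l by (auto simp: proj_lines_def)
  have "vec.span {u, w} \<subseteq> l" using assms s by (intro vec.span_minimal) auto
  moreover have "vec.dim (vec.span {u, w}) = 2"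
    using assms(4) by (simp add: indep2_iff vec.dim_eq_card_independent)
  ultimately show ?thesis
    using s vec.subspace_dim_equal[of "vec.span {u, w}" l] by (metis order_refl vec.subspace_span)
qed

lemma proj_line_span:
  assumes "indep2 u w"
  shows "vec.span {u, w} \<in> proj_lines"
  using assms by (simp add: proj_lines_def indep2_iff vec.dim_eq_card_independent)

text \<open>A point off a line spans the whole space together with it, so every vector can be moved
  into the line along \<open>p\<close>. This is the projection from \<open>p\<close>.\<close>

lemma proj_line_complement:
  assumes l: "l \<in> proj_lines" and p: "p \<notin> l"
  obtains z where "v + z *s p \<in> l"
proof -
  have s: "vec.subspace l" "vec.dim l = 2" using l by (auto simp: proj_lines_def)
  have sp: "vec.span l = l" using s(1) by (simp add: vec.span_eq_iff)
  have "vec.dim (insert p l) = 3"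
    using s(2) p by (simp add: vec.dim_insert sp)
  then have "vec.span (insert p l) = UNIV"
    using vec.dim_eq_full[of "insert p l"] vec_dim_card[where 'a=complex and 'n=3]
    by (simp add: vec.dim_UNIV vec.dimension_def)
  then obtain k where "v - k *s p \<in> vec.span l"
    using vec.span_breakdown_eq[of v p l] by auto
  then have "v + (- k) *s p \<in> l" by (simp add: sp)
  then show thesis by (rule that)
qed

lemma proj_point_span:
  assumes "P \<in> proj_points"
  obtains a where "a \<noteq> 0" "P = vec.span {a}"
proof -
  have s: "vec.subspace P" "vec.dim P = 1" using assms by (auto simp: proj_points_def)
  obtain B where B: "B \<subseteq> P" "vec.independent B" "P \<subseteq> vec.span B" "card B = vec.dim P"
    using vec.basis_exists by metis
  obtain a where a: "B = {a}" using B(4) s(2) card_1_singletonE by metis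
  have "a \<noteq> 0" using B(2) a by auto
  moreover have "P = vec.span {a}" using B a s(1) by (metis subset_antisym vec.span_minimal)
  ultimately show thesis by (rule that)
qed

lemma span_single_subset_iff:
  fixes p :: "complex ^ 3"
  assumes "l \<in> proj_lines" shows "vec.span {p} \<subseteq> l \<longleftrightarrow> p \<in> l"
  using assms vec.span_minimal[of "{p}" l] vec.span_base[of p "{p}"] by (auto simp: proj_lines_def)

lemma span_single_scale:
  fixes a :: "complex ^ 3"
  assumes "c \<noteq> 0" shows "vec.span {c *s a} = vec.span {a}"
proof -
  have "a = (1 / c) *s (c *s a)" using assms by simp
  then show ?thesis unfolding set_eq_iff mem_span_single by (metis vec.scale_scale)
qed

lemma indep2_span_single:
  fixes a b :: "complex ^ 3"
  assumes "a \<noteq> 0" "b \<noteq> 0" "vec.span {a} \<noteq> vec.span {b}"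
  shows "indep2 a b"
  unfolding indep2_def
proof (intro allI impI)
  fix x y assume h: "x *s a + y *s b = 0"
  show "x = 0 \<and> y = 0"
  proof (rule ccontr)
    assume n: "\<not> (x = 0 \<and> y = 0)"
    then have "x \<noteq> 0" "y \<noteq> 0" using h assms by auto
    moreover have "x *s a = (- y) *s b" using h by (simp add: eq_neg_iff_add_eq_0)
    ultimately show False using span_single_scale[of x a] span_single_scale[of "- y" b] assms(3) by simp
  qed
qed

lemma proj_line_extend:
  assumes l: "l \<in> proj_lines" and "a \<in> l" "a \<noteq> 0"
  obtains b where "b \<in> l" "indep2 a b"
proof -
  have s: "vec.subspace l" "vec.dim l = 2" using l by (auto simp: proj_lines_def)
  have "\<not> l \<subseteq> vec.span {a}"
    using vec.dim_mono[of l "{a}"] s assms(3) vec.dim_eq_card_independent[of "{a}"] by auto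
  then obtain b where b: "b \<in> l" "b \<notin> vec.span {a}" by auto
  have "indep2 b a" unfolding indep2_iff
    using b assms(3) vec.span_base[of a "{a}"] by (auto simp: vec.independent_insert)
  then show thesis using b that indep2_sym by blast
qed

section \<open>Quartic forms in polarised form\<close>

lemma quartic_coeffs_zero:
  fixes c0 c1 c2 c3 c4 :: complex
  assumes "\<And>t. c0 + c1 * t + c2 * t ^ 2 + c3 * t ^ 3 + c4 * t ^ 4 = 0"
  shows "c0 = 0 \<and> c1 = 0 \<and> c2 = 0 \<and> c3 = 0 \<and> c4 = 0"
proof -
  have "poly [:c0, c1, c2, c3, c4:] t = poly 0 t" for t
    using assms[of t] by (simp add: algebra_simps power2_eq_square power3_eq_cube power4_eq_xxxx)
  then have "[:c0, c1, c2, c3, c4:] = 0" by (metis poly_eq_poly_eq_iff ext)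
  then show ?thesis by simp
qed

lemma square_roots: "finite {s :: complex. s ^ 2 = r}" "card {s :: complex. s ^ 2 = r} \<le> 2"
proof -
  have "{s. s ^ 2 = r} \<subseteq> {csqrt r, - csqrt r}"
    by (auto, metis power2_csqrt power2_eq_iff)
  then show "finite {s :: complex. s ^ 2 = r}" "card {s :: complex. s ^ 2 = r} \<le> 2"
    using card_mono[of "{csqrt r, - csqrt r}" "{s. s ^ 2 = r}"] card_insert_le_m1[of 2 "{- csqrt r}" "csqrt r"]
    by (auto intro: finite_subset order_trans)
qed

text \<open>Models a quartic through its symmetric 4-linear polarisation: the value at
  \<open>v\<close> is \<open>\<Phi> v v v v\<close>, and \<open>4 * \<Phi> v v v w\<close> is the
  derivative at \<open>v\<close> in direction \<open>w\<close>. The adjacent transpositions generate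
  all permutations, so linearity in the first slot suffices.\<close>

locale quartic_form =
  fixes \<Phi> :: "complex ^ 3 \<Rightarrow> complex ^ 3 \<Rightarrow> complex ^ 3 \<Rightarrow> complex ^ 3 \<Rightarrow> complex"
  assumes add1: "\<Phi> (a + a') b c d = \<Phi> a b c d + \<Phi> a' b c d"
    and scale1: "\<Phi> (r *s a) b c d = r * \<Phi> a b c d"
    and swap12: "\<Phi> a b c d = \<Phi> b a c d"
    and swap23: "\<Phi> a b c d = \<Phi> a c b d"
    and swap34: "\<Phi> a b c d = \<Phi> a b d c"
begin

lemma add2: "\<Phi> a (b + b') c d = \<Phi> a b c d + \<Phi> a b' c d"
  and add3: "\<Phi> a b (c + c') d = \<Phi> a b c d + \<Phi> a b c' d"
  and add4: "\<Phi> a b c (d + d') = \<Phi> a b c d + \<Phi> a b c d'"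
  using add1 swap12 swap23 swap34 by metis+

lemma scale2: "\<Phi> a (r *s b) c d = r * \<Phi> a b c d"
  and scale3: "\<Phi> a b (r *s c) d = r * \<Phi> a b c d"
  and scale4: "\<Phi> a b c (r *s d) = r * \<Phi> a b c d"
  using scale1 swap12 swap23 swap34 by metis+

lemma minus: "\<Phi> (- a) b c d = - \<Phi> a b c d" "\<Phi> a (- b) c d = - \<Phi> a b c d"
    "\<Phi> a b (- c) d = - \<Phi> a b c d" "\<Phi> a b c (- d) = - \<Phi> a b c d"
  using scale1[of "- 1"] scale2[of _ "- 1"] scale3[of _ _ "- 1"] scale4[of _ _ _ "- 1"] by simp_all

lemma diff: "\<Phi> (a - a') b c d = \<Phi> a b c d - \<Phi> a' b c d"
    "\<Phi> a (b - b') c d = \<Phi> a b c d - \<Phi> a b' c d"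
    "\<Phi> a b (c - c') d = \<Phi> a b c d - \<Phi> a b c' d"
    "\<Phi> a b c (d - d') = \<Phi> a b c d - \<Phi> a b c d'"
  using add1[of a "- a'"] add2[of _ b "- b'"] add3[of _ _ c "- c'"] add4[of _ _ _ d "- d'"]
  by (simp_all add: minus)

lemmas multilinear = add1 add2 add3 add4 scale1 scale2 scale3 scale4 minus diff
lemmas swaps = swap12 swap23 swap34

lemma zero: "\<Phi> 0 b c d = 0" "\<Phi> a 0 c d = 0" "\<Phi> a b 0 d = 0" "\<Phi> a b c 0 = 0"
  using scale1[of 0] scale2[of _ 0] scale3[of _ _ 0] scale4[of _ _ _ 0] by simp_all

lemma diag_line:
  "\<Phi> (x *s a + y *s b) (x *s a + y *s b) (x *s a + y *s b) (x *s a + y *s b) =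
   x ^ 4 * \<Phi> a a a a + 4 * x ^ 3 * y * \<Phi> a a a b + 6 * x ^ 2 * y ^ 2 * \<Phi> a a b b
   + 4 * x * y ^ 3 * \<Phi> a b b b + y ^ 4 * \<Phi> b b b b"
  unfolding multilinear
  by (simp add: swaps) (simp add: algebra_simps power2_eq_square power3_eq_cube power4_eq_xxxx)


text \<open>The two alternatives are distinct points of contact \<open>a\<close> and \<open>b\<close>, and a single point of contact \<open>a\<close>.\<close>
definition bitangent_line :: "(complex ^ 3) set \<Rightarrow> bool" where
  "bitangent_line l \<longleftrightarrow> l \<in> proj_lines \<and>
     (\<exists>a b. indep2 a b \<and> l = vec.span {a, b} \<and>
        \<Phi> a a a a = 0 \<and> \<Phi> a a a b = 0 \<and> \<Phi> a b b b = 0 \<and>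
        (\<Phi> b b b b = 0 \<and> \<Phi> a a b b \<noteq> 0 \<or> \<Phi> a a b b = 0 \<and> \<Phi> b b b b \<noteq> 0))"

lemma bitangent_lineD: "bitangent_line l \<Longrightarrow> l \<in> proj_lines"
  by (simp add: bitangent_line_def)

text \<open>In coordinates X, Y dual to \<open>a\<close>, \<open>b\<close>, the form on the line is
  a multiple of X^2 Y^2 for two contacts, or of Y^4 for one; either is the square of a quadratic
  form \<open>S\<close>. The cross term of \<open>S\<close> is \<open>\<Sigma>\<close>.\<close>

lemma bitangent_sqrt:
  assumes "bitangent_line l"
  obtains S \<Sigma> where
    "\<And>v. v \<in> l \<Longrightarrow> \<Phi> v v v v = S v ^ 2"
    "\<And>x y u w. S (x *s u + y *s w) = x ^ 2 * S u + x * y * \<Sigma> u w + y ^ 2 * S w"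
proof -
  obtain a b where ab: "indep2 a b" "l = vec.span {a, b}"
    and z: "\<Phi> a a a a = 0" "\<Phi> a a a b = 0" "\<Phi> a b b b = 0"
    and c: "\<Phi> b b b b = 0 \<and> \<Phi> a a b b \<noteq> 0 \<or> \<Phi> a a b b = 0 \<and> \<Phi> b b b b \<noteq> 0"
    using assms unfolding bitangent_line_def by auto
  \<comment> \<open>The dual coordinates are extended to the whole space, so that the expansion of
    \<open>S\<close> needs no membership in \<open>l\<close>.\<close>
  obtain g :: "complex ^ 3 \<Rightarrow> complex ^ 3" where lin: "Vector_Spaces.linear (*s) (*s) g"
    and g: "\<forall>x\<in>{a, b}. g x = (if x = a then axis 1 1 else axis 2 1)"
    using vec.linear_independent_extend[of "{a, b}" "\<lambda>x. if x = a then axis 1 1 else axis 2 1"]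
      ab(1) indep2_iff by blast
  have ga: "g a = axis 1 1" and gb: "g b = axis 2 1" using g ab(1) by (auto simp: indep2_iff)
  define X where "X v = g v $ 1" for v
  define Y where "Y v = g v $ 2" for v
  have g_comb: "g (x *s u + y *s w) = x *s g u + y *s g w" for x y u w
    using lin by (simp add: Vector_Spaces.linear.axioms linear_iff vec.linear_add vec.linear_scale)
  have X: "X (x *s u + y *s w) = x * X u + y * X w"
    and Y: "Y (x *s u + y *s w) = x * Y u + y * Y w" for x y u w
    by (simp_all add: X_def Y_def g_comb)
  have XY: "X a = 1" "X b = 0" "Y a = 0" "Y b = 1"
    by (simp_all add: X_def Y_def ga gb axis_def)
  have val: "\<Phi> v v v v = 6 * X v ^ 2 * Y v ^ 2 * \<Phi> a a b b + Y v ^ 4 * \<Phi> b b b b"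
    if v: "v \<in> l" for v
  proof -
    obtain x y where "v = x *s a + y *s b" using v unfolding ab(2) mem_span_pair by blast
    moreover have "X (x *s a + y *s b) = x" "Y (x *s a + y *s b) = y" by (simp_all only: X Y XY, simp_all)
    ultimately show ?thesis using diag_line[of x a y b] z by simp
  qed
  show thesis
  proof (cases "\<Phi> b b b b = 0")
    case True
    define k where "k = csqrt (6 * \<Phi> a a b b)"
    have k: "k ^ 2 = 6 * \<Phi> a a b b" by (simp add: k_def)
    show thesis
    proof (rule that)
      show "\<Phi> v v v v = (k * X v * Y v) ^ 2" if "v \<in> l" for v
        using val[OF that] True k by (simp add: power_mult_distrib)
      show "k * X (x *s u + y *s w) * Y (x *s u + y *s w) = x\<^sup>2 * (k * X u * Y u)
        + x * y * (k * (X u * Y w + X w * Y u)) + y\<^sup>2 * (k * X w * Y w)" for x y u w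
        unfolding X Y by (simp add: algebra_simps power2_eq_square)
    qed
  next
    case False
    define k where "k = csqrt (\<Phi> b b b b)"
    have k: "k ^ 2 = \<Phi> b b b b" by (simp add: k_def)
    show thesis
    proof (rule that)
      show "\<Phi> v v v v = (k * Y v * Y v) ^ 2" if "v \<in> l" for v
        using val[OF that] False c k by (simp add: power_mult_distrib flip: power_add)
      show "k * Y (x *s u + y *s w) * Y (x *s u + y *s w) = x\<^sup>2 * (k * Y u * Y u)
        + x * y * (k * (Y u * Y w + Y w * Y u)) + y\<^sup>2 * (k * Y w * Y w)" for x y u w
        unfolding X Y by (simp add: algebra_simps power2_eq_square)
    qed
  qed
qed

text \<open>Comparison of the coefficients of \<open>t\<close> in the form at \<open>u + t w\<close>
  and in the square of \<open>S\<close> there.\<close>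

lemma bitangent_square:
  assumes "bitangent_line l"
  obtains S \<Sigma> where
    "\<And>x y u w. S (x *s u + y *s w) = x ^ 2 * S u + x * y * \<Sigma> u w + y ^ 2 * S w"
    "\<And>u. u \<in> l \<Longrightarrow> \<Phi> u u u u = S u ^ 2"
    "\<And>u w. u \<in> l \<Longrightarrow> w \<in> l \<Longrightarrow> 4 * \<Phi> u u u w = 2 * S u * \<Sigma> u w"
    "\<And>u w. u \<in> l \<Longrightarrow> w \<in> l \<Longrightarrow> 6 * \<Phi> u u w w = \<Sigma> u w ^ 2 + 2 * S u * S w"
    "\<And>u w. u \<in> l \<Longrightarrow> w \<in> l \<Longrightarrow> 4 * \<Phi> u w w w = 2 * \<Sigma> u w * S w"
proof -
  obtain S \<Sigma> where S: "\<And>v. v \<in> l \<Longrightarrow> \<Phi> v v v v = S v ^ 2"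
    and lin: "\<And>x y u w. S (x *s u + y *s w) = x ^ 2 * S u + x * y * \<Sigma> u w + y ^ 2 * S w"
    using bitangent_sqrt[OF assms(1)] by blast
  have sub: "vec.subspace l" using assms(1) by (simp add: bitangent_line_def proj_lines_def)
  have "4 * \<Phi> u u u w = 2 * S u * \<Sigma> u w \<and> 6 * \<Phi> u u w w = \<Sigma> u w ^ 2 + 2 * S u * S w \<and>
      4 * \<Phi> u w w w = 2 * \<Sigma> u w * S w" if uw: "u \<in> l" "w \<in> l" for u w
  proof -
    have "(\<Phi> u u u u - S u ^ 2) + (4 * \<Phi> u u u w - 2 * S u * \<Sigma> u w) * t
        + (6 * \<Phi> u u w w - (\<Sigma> u w ^ 2 + 2 * S u * S w)) * t ^ 2
        + (4 * \<Phi> u w w w - 2 * \<Sigma> u w * S w) * t ^ 3 + (\<Phi> w w w w - S w ^ 2) * t ^ 4 = 0" for t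
    proof -
      have "1 *s u + t *s w \<in> l" using uw sub by (intro vec.subspace_add vec.subspace_scale)
      then have "\<Phi> (1 *s u + t *s w) (1 *s u + t *s w) (1 *s u + t *s w) (1 *s u + t *s w)
          = (S u + t * \<Sigma> u w + t ^ 2 * S w) ^ 2"
        using S lin[of 1 u t w] by simp
      then show ?thesis unfolding diag_line
        by (simp add: algebra_simps power2_eq_square power3_eq_cube power4_eq_xxxx)
    qed
    from quartic_coeffs_zero[OF this] show ?thesis by simp
  qed
  then show thesis using S lin by (intro that[of S \<Sigma>]) blast+
qed

end

text \<open>Smoothness without the condition that \<open>v\<close> lies on the curve: off the curve
  \<open>w = v\<close> is always a witness.\<close>

locale smooth_quartic_form = quartic_form +
  assumes smooth: "v \<noteq> 0 \<Longrightarrow> \<exists>w. \<Phi> v v v w \<noteq> 0"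
begin

section \<open>Points on four bitangents are centres of homologies\<close>

text \<open>Since \<open>\<Phi> p p p p\<close> is nonzero, the plane
  \<open>\<Phi> p p p v = 0\<close> is complementary to \<open>p\<close>. In the decomposition s p +
  v, the s^3 term vanishes by the choice of plane and the s term by the second condition, so the
  form is even in s.\<close>

definition homology_centre :: "complex ^ 3 \<Rightarrow> bool" where
  "homology_centre p \<longleftrightarrow> \<Phi> p p p p \<noteq> 0 \<and>
     (\<forall>u v w. \<Phi> p p p u = 0 \<longrightarrow> \<Phi> p p p v = 0 \<longrightarrow> \<Phi> p p p w = 0 \<longrightarrow> \<Phi> p u v w = 0)"

lemma hyperplane_span:
  assumes "\<Phi> p p p p \<noteq> 0" "\<Phi> p p p u = 0" "\<Phi> p p p w = 0" "indep2 u w" "\<Phi> p p p v = 0"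
  obtains x y where "v = x *s u + y *s w"
proof -
  have "p \<notin> vec.span {u, w}"
    using assms by (auto simp: mem_span_pair multilinear)
  then obtain z where "v + z *s p \<in> vec.span {u, w}"
    using proj_line_complement[OF proj_line_span[OF assms(4)]] by metis
  then obtain x y where e: "v + z *s p = x *s u + y *s w" by (auto simp: mem_span_pair)
  have "\<Phi> p p p (v + z *s p) = 0" unfolding e using assms by (simp add: multilinear)
  then have "z = 0" using assms by (simp add: multilinear)
  then show thesis using e that by auto
qed

lemma line_hyperplane:
  assumes l: "l \<in> proj_lines" "p \<in> l" and p: "\<Phi> p p p p \<noteq> 0"
  obtains v where "v \<in> l" "v \<noteq> 0" "\<Phi> p p p v = 0" "l = vec.span {p, v}"
proof -
  have "p \<noteq> 0" using p zero by auto
  then obtain q where q: "q \<in> l" "indep2 p q" using proj_line_extend l by blast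
  \<comment> \<open>Chosen so that \<open>z *s p + q\<close> lies in the plane complementary to
    \<open>p\<close>.\<close>
  define z where "z = - \<Phi> p p p q / \<Phi> p p p p"
  define v where "v = z *s p + 1 *s q"
  have "v \<in> l" using l q unfolding v_def proj_lines_def
    by (intro vec.subspace_add vec.subspace_scale) auto
  moreover have v0: "v \<noteq> 0" using indep2D[OF q(2), of z 1] by (auto simp: v_def)
  moreover have pv: "\<Phi> p p p v = 0" using p by (simp add: v_def multilinear z_def)
  moreover have "indep2 p v" unfolding indep2_def
  proof (intro allI impI)
    fix x y assume h: "x *s p + y *s v = 0"
    have "\<Phi> p p p (x *s p + y *s v) = 0" unfolding h by (rule zero)
    then have "x = 0" using p pv by (simp add: multilinear)
    then show "x = 0 \<and> y = 0" using h v0 by auto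
  qed
  ultimately show thesis using that proj_line_eq_span[OF l(1) l(2)] by blast
qed

text \<open>The quadratic square root on the line has leading coefficient \<open>A\<close>, nonzero
  because \<open>p\<close> is off the curve. As \<open>\<Phi> p p p v = 0\<close>, its cross term
  \<open>B\<close> vanishes, so the form is (A x^2 + C y^2)^2.\<close>

lemma bitangent_through:
  assumes "bitangent_line l" "p \<in> l" "v \<in> l" "\<Phi> p p p p \<noteq> 0" "\<Phi> p p p v = 0"
  shows "\<Phi> p v v v = 0" "9 * \<Phi> p p v v ^ 2 = \<Phi> p p p p * \<Phi> v v v v"
proof -
  obtain A B C where c: "\<Phi> p p p p = A ^ 2" "4 * \<Phi> p p p v = 2 * A * B"
    "6 * \<Phi> p p v v = B ^ 2 + 2 * A * C" "4 * \<Phi> p v v v = 2 * B * C" "\<Phi> v v v v = C ^ 2"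
    using bitangent_square[OF assms(1)] assms(2,3) by metis
  have "A \<noteq> 0" using c assms by auto
  then have B: "B = 0" using c assms by simp
  show "\<Phi> p v v v = 0" using c B by simp
  have "3 * \<Phi> p p v v = A * C" using c B by simp
  then have "(3 * \<Phi> p p v v) ^ 2 = (A * C) ^ 2" by simp
  then show "9 * \<Phi> p p v v ^ 2 = \<Phi> p p p p * \<Phi> v v v v" using c by (simp add: power_mult_distrib)
qed

text \<open>Were \<open>p\<close> on the curve, both bitangents would be tangent there. Two distinct
  lines through \<open>p\<close> span the space, so the gradient at \<open>p\<close> would vanish,
  against smoothness.\<close>

lemma not_on_curve_if_two_bitangents:
  assumes l: "bitangent_line l" "p \<in> l" and l': "bitangent_line l'" "p \<in> l'"
    and "l \<noteq> l'" "p \<noteq> 0"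
  shows "\<Phi> p p p p \<noteq> 0"
proof
  assume p: "\<Phi> p p p p = 0"
  have van: "\<Phi> p p p q = 0" if "bitangent_line m" "p \<in> m" "q \<in> m" for q m
    using bitangent_square[OF that(1)] that(2,3) p
    by (metis mult_eq_0_iff mult_zero_left power_eq_0_iff zero_neq_numeral)
  have "\<not> l' \<subseteq> l"
    using assms vec.subspace_dim_equal[of l' l] by (auto simp: bitangent_line_def proj_lines_def)
  then obtain q where q: "q \<in> l'" "q \<notin> l" by auto
  have "\<Phi> p p p v = 0" for v
  proof -
    obtain z where "v + z *s q \<in> l"
      using proj_line_complement[OF bitangent_lineD[OF l(1)] q(2)] by metis
    from van[OF l this] show ?thesis using van[OF l' q(1)] by (simp add: multilinear)
  qed
  then show False using smooth[OF assms(6)] by blast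
qed

lemma indep2_of_bitangents:
  assumes "l = vec.span {p, v}" "l' = vec.span {p, v'}" "l \<in> proj_lines" "l' \<in> proj_lines"
    "l \<noteq> l'" "v \<noteq> 0" "v' \<noteq> 0"
  shows "indep2 v v'"
proof (rule indep2_span_single)
  show "vec.span {v} \<noteq> vec.span {v'}"
  proof
    assume e: "vec.span {v} = vec.span {v'}"
    have "v' \<in> vec.span {v}" "v \<in> vec.span {v'}"
      using e vec.span_base[of v "{v}"] vec.span_base[of v' "{v'}"] by auto
    then have "v' \<in> l" "v \<in> l'"
      using assms(1,2) vec.span_mono[of "{v}" "{p, v}"] vec.span_mono[of "{v'}" "{p, v'}"] by auto
    moreover have "p \<in> l" "p \<in> l'" using assms(1,2) by (auto intro: vec.span_base)
    ultimately have "vec.span {p, v'} \<subseteq> l" "vec.span {p, v} \<subseteq> l'"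
      using assms(3,4) vec.span_minimal[of "{p, v'}" l] vec.span_minimal[of "{p, v}" l']
      by (simp_all add: proj_lines_def)
    then show False using assms(1,2,5) by auto
  qed
qed fact+

text \<open>The cubic form \<open>\<Phi> p v v v\<close> on the plane \<open>\<Phi> p p p v = 0\<close> has a zero on each of the four bitangents,
  hence vanishes.\<close>
lemma four_bitangents_homology_centre:
  fixes v :: "nat \<Rightarrow> complex ^ 3"
  assumes p: "\<Phi> p p p p \<noteq> 0"
    and h: "\<And>i. i < 4 \<Longrightarrow> \<Phi> p p p (v i) = 0" "\<And>i. i < 4 \<Longrightarrow> \<Phi> p (v i) (v i) (v i) = 0"
    and ind: "\<And>i j. i < 4 \<Longrightarrow> j < 4 \<Longrightarrow> i \<noteq> j \<Longrightarrow> indep2 (v i) (v j)"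
  shows "homology_centre p"
proof -
  define a b where "a = v 0" and "b = v 1"
  have ab: "indep2 a b" "\<Phi> p p p a = 0" "\<Phi> p p p b = 0" "\<Phi> p a a a = 0" "\<Phi> p b b b = 0"
    using h[of 0] h[of 1] ind[of 0 1] by (auto simp: a_def b_def)
  \<comment> \<open>With zeros at \<open>a\<close> and \<open>b\<close> the cubic keeps only its two
    middle coefficients; each further zero is a linear equation for them, and the two equations are
    independent.\<close>
  have "\<exists>x y. v i = x *s a + y *s b \<and> x \<noteq> 0 \<and> y \<noteq> 0 \<and> x * \<Phi> p a a b + y * \<Phi> p a b b = 0"
    if i: "i \<in> {2, 3}" for i
  proof -
    obtain x y where e: "v i = x *s a + y *s b"
      using hyperplane_span[OF p ab(2,3,1), of "v i"] h(1)[of i] i by force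
    have x: "x \<noteq> 0"
    proof
      assume "x = 0"
      then have "1 *s v i + (- y) *s b = 0" using e by simp
      moreover have "indep2 (v i) b" using ind[of i 1] i by (auto simp: b_def)
      ultimately show False using indep2D by (metis one_neq_zero)
    qed
    have y: "y \<noteq> 0"
    proof
      assume "y = 0"
      then have "1 *s v i + (- x) *s a = 0" using e by simp
      moreover have "indep2 (v i) a" using ind[of i 0] i by (auto simp: a_def)
      ultimately show False using indep2D by (metis one_neq_zero)
    qed
    have "\<Phi> p (v i) (v i) (v i) = 3 * x * y * (x * \<Phi> p a a b + y * \<Phi> p a b b)"
      unfolding e multilinear using ab by (simp add: swaps) (simp add: algebra_simps)
    moreover have "\<Phi> p (v i) (v i) (v i) = 0" using h(2)[of i] i by auto
    ultimately show ?thesis using x y e by auto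
  qed
  from this[of 2] this[of 3] obtain x y x' y' where
    e: "v 2 = x *s a + y *s b" "x \<noteq> 0" "y \<noteq> 0" "x * \<Phi> p a a b + y * \<Phi> p a b b = 0" and
    e': "v 3 = x' *s a + y' *s b" "x' \<noteq> 0" "y' \<noteq> 0" "x' * \<Phi> p a a b + y' * \<Phi> p a b b = 0"
    by auto
  have det: "x * y' - x' * y \<noteq> 0"
  proof
    assume "x * y' - x' * y = 0"
    then have "x' *s v 2 + (- x) *s v 3 = 0"
      by (simp add: e e' vec_eq_iff algebra_simps)
    then show False using ind[of 2 3] indep2D e(2) by fastforce
  qed
  have "(x * y' - x' * y) * \<Phi> p a a b = y' * (x * \<Phi> p a a b + y * \<Phi> p a b b) - y * (x' * \<Phi> p a a b + y' * \<Phi> p a b b)"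
    by (simp add: algebra_simps)
  then have z1: "\<Phi> p a a b = 0" using e e' det by simp
  then have z2: "\<Phi> p a b b = 0" using e by simp
  show ?thesis unfolding homology_centre_def
  proof (intro conjI allI impI p)
    fix r s t assume rst: "\<Phi> p p p r = 0" "\<Phi> p p p s = 0" "\<Phi> p p p t = 0"
    obtain r1 r2 where r: "r = r1 *s a + r2 *s b" using hyperplane_span[OF p ab(2,3,1) rst(1)] .
    obtain s1 s2 where s: "s = s1 *s a + s2 *s b" using hyperplane_span[OF p ab(2,3,1) rst(2)] .
    obtain t1 t2 where t: "t = t1 *s a + t2 *s b" using hyperplane_span[OF p ab(2,3,1) rst(3)] .
    show "\<Phi> p r s t = 0"
      unfolding r s t multilinear using z1 z2 ab(4,5) by (simp add: swaps)
  qed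
qed

text \<open>Terms with exactly one \<open>p\<close> vanish by \<open>homology_centre\<close>, terms
  with exactly three by the choice of plane; only even numbers of \<open>p\<close> survive.\<close>

lemma centre_expand:
  assumes p: "homology_centre p"
    and h: "\<Phi> p p p a = 0" "\<Phi> p p p b = 0" "\<Phi> p p p c = 0" "\<Phi> p p p d = 0"
  shows "\<Phi> (x *s p + a) (y *s p + b) (z *s p + c) (t *s p + d) =
    x * y * z * t * \<Phi> p p p p + x * y * \<Phi> p p c d + x * z * \<Phi> p p b d + x * t * \<Phi> p p b c
    + y * z * \<Phi> p p a d + y * t * \<Phi> p p a c + z * t * \<Phi> p p a b + \<Phi> a b c d"
proof -
  have o: "\<Phi> p b c d = 0" "\<Phi> p a c d = 0" "\<Phi> p a b d = 0" "\<Phi> p a b c = 0"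
    using p h by (auto simp: homology_centre_def)
  show ?thesis using o h unfolding multilinear by (simp add: swaps) (simp add: algebra_simps)
qed

lemma centre_proj:
  assumes "homology_centre p"
  shows "\<Phi> p p p (a - (\<Phi> p p p a / \<Phi> p p p p) *s p) = 0"
  using assms by (simp add: homology_centre_def multilinear)

text \<open>The map \<open>\<sigma>\<close> fixes the plane \<open>\<Phi> p p p v = 0\<close>
  pointwise and negates \<open>p\<close>; an even form does not see the sign.\<close>

lemma homology_invariant:
  assumes p: "homology_centre p"
  defines "\<sigma> \<equiv> \<lambda>a. a - (2 * \<Phi> p p p a / \<Phi> p p p p) *s p"
  shows "\<Phi> (\<sigma> a) (\<sigma> b) (\<sigma> c) (\<sigma> d) = \<Phi> a b c d"
proof -
  define x where "x a = \<Phi> p p p a / \<Phi> p p p p" for a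
  define h where "h a = a - x a *s p" for a
  have \<sigma>: "\<sigma> a = (- x a) *s p + h a" and id: "a = x a *s p + h a" for a
    by (simp_all add: \<sigma>_def x_def h_def vec_eq_iff algebra_simps)
  have h: "\<Phi> p p p (h a) = 0" for a unfolding h_def x_def by (rule centre_proj[OF p])
  have "\<Phi> (\<sigma> a) (\<sigma> b) (\<sigma> c) (\<sigma> d) =
      \<Phi> (x a *s p + h a) (x b *s p + h b) (x c *s p + h c) (x d *s p + h d)"
    unfolding \<sigma> centre_expand[OF p h h h h] by simp
  then show ?thesis by (simp flip: id)
qed

section \<open>A bitangent contains at most three centres\<close>

text \<open>The homology of a centre on \<open>l\<close> preserves \<open>l\<close> and its
  contacts. Two contacts are swapped, \<open>a\<close> going to \<open>r *s b\<close>, and the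
  gradients at \<open>a\<close> and \<open>b\<close> determine \<open>r ^ 3\<close>; the centre is
  spanned by \<open>a - r *s b\<close>. A single contact \<open>a\<close> is fixed, and comparing
  \<open>\<Phi> a a b e\<close> before and after leaves one possible centre.\<close>

lemma card_centres_on_bitangent:
  assumes "bitangent_line l"
  defines "Z \<equiv> {vec.span {p} |p. p \<in> l \<and> homology_centre p}"
  shows "finite Z \<and> card Z \<le> 3"
proof -
  obtain a b where ab: "indep2 a b" "l = vec.span {a, b}"
    and z: "\<Phi> a a a a = 0" "\<Phi> a a a b = 0" "\<Phi> a b b b = 0"
    and c: "\<Phi> b b b b = 0 \<and> \<Phi> a a b b \<noteq> 0 \<or> \<Phi> a a b b = 0 \<and> \<Phi> b b b b \<noteq> 0"
    using assms unfolding bitangent_line_def by auto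
  have "a \<noteq> 0" using indep2D[OF ab(1), of 1 0] by auto
  then obtain e where e: "\<Phi> a a a e \<noteq> 0" using smooth by blast
  show ?thesis
  proof (cases "\<Phi> b b b b = 0")
    case True
    then have m: "\<Phi> a a b b \<noteq> 0" using c by auto
    \<comment> \<open>Nonzero because of \<open>e\<close>. If \<open>\<Phi> b b b e = 0\<close> this
      is a nonzero constant without roots, and the bound still holds.\<close>
    define R where "R = {r. poly [:- \<Phi> a a a e, 0, 0, \<Phi> b b b e:] r = 0}"
    have R: "finite R" "card R \<le> 3"
      using e poly_roots_finite[of "[:- \<Phi> a a a e, 0, 0, \<Phi> b b b e:]"]
        card_poly_roots_bound[of "[:- \<Phi> a a a e, 0, 0, \<Phi> b b b e:]"]
      by (auto simp: R_def intro: order_trans split: if_splits)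
    have "Z \<subseteq> (\<lambda>r. vec.span {a + (- r) *s b}) ` R"
    proof
      fix P assume "P \<in> Z"
      then obtain p where P: "P = vec.span {p}" and pl: "p \<in> l" and p: "homology_centre p"
        by (auto simp: Z_def)
      obtain x y where pxy: "p = x *s a + y *s b" using pl unfolding ab(2) mem_span_pair by blast
      have k: "\<Phi> p p p p = 6 * x ^ 2 * y ^ 2 * \<Phi> a a b b"
        unfolding pxy diag_line using z True by simp
      have xy: "x \<noteq> 0" "y \<noteq> 0" using k p by (auto simp: homology_centre_def)
      have pa: "\<Phi> p p p a = 3 * x * y ^ 2 * \<Phi> a a b b"
        unfolding pxy multilinear using z True by (simp add: swaps) (simp add: algebra_simps power2_eq_square)
      define r where "r = - y / x"
      define \<mu> where "\<mu> = 2 * \<Phi> p p p e / \<Phi> p p p p"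
      have co: "2 * \<Phi> p p p a / \<Phi> p p p p = 1 / x"
        using xy m by (simp add: k pa field_simps power2_eq_square)
      have sa: "a - (2 * \<Phi> p p p a / \<Phi> p p p p) *s p = r *s b"
        unfolding co using xy by (simp add: r_def pxy vec_eq_iff field_simps)
      \<comment> \<open>The homology also shifts \<open>e\<close> by a multiple of \<open>p\<close>,
        which is invisible here: \<open>p\<close> lies on the tangent at \<open>b\<close>.\<close>
      have bp: "\<Phi> b b b p = 0"
        unfolding pxy using z True by (simp add: multilinear swaps)
      have "\<Phi> (r *s b) (r *s b) (r *s b) (e - \<mu> *s p) = \<Phi> a a a e"
        using homology_invariant[OF p, of a a a e] unfolding sa \<mu>_def .
      then have "r ^ 3 * \<Phi> b b b e = \<Phi> a a a e"
        by (simp add: multilinear bp power3_eq_cube algebra_simps)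
      then have "r \<in> R" by (simp add: R_def power3_eq_cube algebra_simps)
      moreover have "p = x *s (a + (- r) *s b)"
        using xy by (simp add: pxy r_def vec_eq_iff field_simps)
      then have "P = vec.span {a + (- r) *s b}" unfolding P using xy span_single_scale by metis
      ultimately show "P \<in> (\<lambda>r. vec.span {a + (- r) *s b}) ` R" by blast
    qed
    then show ?thesis using R by (meson card_image_le card_mono finite_imageI finite_subset order_trans)
  next
    case False
    then have m: "\<Phi> a a b b = 0" using c by auto
    have "Z \<subseteq> {vec.span {b - (\<Phi> a a b e / \<Phi> a a a e) *s a}}"
    proof
      fix P assume "P \<in> Z"
      then obtain p where P: "P = vec.span {p}" and pl: "p \<in> l" and p: "homology_centre p"
        by (auto simp: Z_def)
      obtain x y where pxy: "p = x *s a + y *s b" using pl unfolding ab(2) mem_span_pair by blast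
      have k: "\<Phi> p p p p = y ^ 4 * \<Phi> b b b b"
        unfolding pxy diag_line using z m by simp
      have y: "y \<noteq> 0" using k p by (auto simp: homology_centre_def)
      have pa: "\<Phi> p p p a = 0" and pb: "\<Phi> p p p b = y ^ 3 * \<Phi> b b b b"
        unfolding pxy multilinear using z m by (simp_all add: swaps power3_eq_cube)
      define t where "t = x / y"
      define \<mu> where "\<mu> = 2 * \<Phi> p p p e / \<Phi> p p p p"
      have co: "2 * \<Phi> p p p b / \<Phi> p p p p = 2 / y"
        using y False by (simp add: k pb field_simps power3_eq_cube power4_eq_xxxx)
      have sb: "b - (2 * \<Phi> p p p b / \<Phi> p p p p) *s p = - b - (2 * t) *s a"
        unfolding co using y by (simp add: t_def pxy vec_eq_iff field_simps)
      have "\<Phi> a a (- b - (2 * t) *s a) (e - \<mu> *s p) = \<Phi> a a b e"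
        using homology_invariant[OF p, of a a b e] unfolding sb \<mu>_def by (simp add: pa)
      \<comment> \<open>Again the shift of \<open>e\<close> along \<open>p\<close> drops
        out.\<close>
      moreover have "\<Phi> a a a p = 0" "\<Phi> a a b p = 0"
        unfolding pxy using z m by (simp_all add: multilinear swaps)
      ultimately have "2 * (t * \<Phi> a a a e + \<Phi> a a b e) = 0"
        by (simp add: multilinear algebra_simps)
      then have "t * \<Phi> a a a e = - \<Phi> a a b e"
        by (metis eq_neg_iff_add_eq_0 mult_eq_0_iff zero_neq_numeral)
      then have "t = - \<Phi> a a b e / \<Phi> a a a e" using e by (simp add: field_simps)
      moreover have "p = y *s (b + t *s a)"
        using y by (simp add: pxy t_def vec_eq_iff field_simps)
      ultimately show "P \<in> {vec.span {b - (\<Phi> a a b e / \<Phi> a a a e) *s a}}"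
        unfolding P using span_single_scale[OF y, of "b + t *s a"] by simp
    qed
    then show ?thesis using card_mono[of "{vec.span {b - (\<Phi> a a b e / \<Phi> a a a e) *s a}}" Z]
      by (auto intro: finite_subset)
  qed
qed

section \<open>The bitangents missing a centre\<close>

text \<open>On the plane \<open>\<Phi> p p p v = 0\<close> put \<open>Q v = \<Phi> p p v v\<close>, \<open>k = \<Phi> p p p p\<close> and \<open>D v = 9 (Q v)\<^sup>2 - k \<Phi> v v v v\<close>,
  so that \<open>k \<Phi> m m m m = (k s\<^sup>2 + 3 Q v)\<^sup>2 - D v\<close> for \<open>m = s p + v\<close>. The following two numbers are the
  coefficients of \<open>x\<^sup>3 y\<close> and \<open>x\<^sup>2 y\<^sup>2\<close> in \<open>D (x u + y w)\<close>.\<close>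
definition D31 :: "complex ^ 3 \<Rightarrow> complex ^ 3 \<Rightarrow> complex ^ 3 \<Rightarrow> complex" where
  "D31 p u w = 36 * \<Phi> p p u u * \<Phi> p p u w - 4 * \<Phi> p p p p * \<Phi> u u u w"

definition D22 :: "complex ^ 3 \<Rightarrow> complex ^ 3 \<Rightarrow> complex ^ 3 \<Rightarrow> complex" where
  "D22 p u w = 36 * \<Phi> p p u w ^ 2 + 18 * \<Phi> p p u u * \<Phi> p p w w - 6 * \<Phi> p p p p * \<Phi> u u w w"

text \<open>If \<open>D\<close> had a multiple root, the form would be singular at a point \<open>s p + u\<close> with \<open>k s\<^sup>2 + 3 Q u = 0\<close>.\<close>
lemma D31_nonzero:
  assumes p: "homology_centre p" and u: "\<Phi> p p p u = 0" and w: "\<Phi> p p p w = 0"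
    and ind: "indep2 u w" and D: "9 * \<Phi> p p u u ^ 2 = \<Phi> p p p p * \<Phi> u u u u"
  shows "D31 p u w \<noteq> 0"
proof
  assume "D31 p u w = 0"
  then have D': "9 * \<Phi> p p u u * \<Phi> p p u w = \<Phi> p p p p * \<Phi> u u u w" by (simp add: D31_def mult.assoc)
  have k: "\<Phi> p p p p \<noteq> 0" using p by (simp add: homology_centre_def)
  define s where "s = csqrt (- 3 * \<Phi> p p u u / \<Phi> p p p p)"
  have s: "\<Phi> p p p p * s ^ 2 = - 3 * \<Phi> p p u u" using k by (simp add: s_def)
  define v where "v = s *s p + u"
  have "v \<noteq> 0"
  proof
    assume v: "v = 0"
    have "\<Phi> p p p v = 0" unfolding v by (rule zero)
    then have "s = 0" using u k by (simp add: v_def multilinear)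
    then show False using v indep2D[OF ind, of 1 0] by (simp add: v_def)
  qed
  then obtain z where z: "\<Phi> v v v z \<noteq> 0" using smooth by blast
  define t where "t = \<Phi> p p p z / \<Phi> p p p p"
  obtain x y where "z - t *s p = x *s u + y *s w"
    using hyperplane_span[OF k u w ind centre_proj[OF p, of z]] unfolding t_def by metis
  then have z_eq: "z = t *s p + x *s u + y *s w" by (metis add.assoc diff_add_cancel add.commute)
  have 0: "\<Phi> p p p 0 = 0" by (rule zero)
  \<comment> \<open>The gradient at \<open>v\<close> is tested on \<open>p\<close>,
    \<open>u\<close>, \<open>w\<close>, which span the space. The choice of \<open>s\<close> settles
    \<open>p\<close>, the root \<open>u\<close> of D settles \<open>u\<close>, and the assumed
    vanishing of \<open>D31\<close> settles \<open>w\<close>.\<close>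
  have "\<Phi> v v v p = s * (\<Phi> p p p p * s ^ 2 + 3 * \<Phi> p p u u)"
    using centre_expand[OF p u u u 0, of s s s 1] unfolding v_def
    by (simp add: zero algebra_simps power2_eq_square)
  then have vp: "\<Phi> v v v p = 0" using s by simp
  have "\<Phi> p p p p * \<Phi> v v v u = 3 * \<Phi> p p u u * (\<Phi> p p p p * s ^ 2) + \<Phi> p p p p * \<Phi> u u u u"
    using centre_expand[OF p u u u u, of s s s 0] unfolding v_def
    by (simp add: zero algebra_simps power2_eq_square)
  then have vu: "\<Phi> v v v u = 0"
    unfolding s D[symmetric] using k by (simp add: power2_eq_square)
  have "\<Phi> p p p p * \<Phi> v v v w = 3 * \<Phi> p p u w * (\<Phi> p p p p * s ^ 2) + \<Phi> p p p p * \<Phi> u u u w"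
    using centre_expand[OF p u u u w, of s s s 0] unfolding v_def
    by (simp add: zero algebra_simps power2_eq_square)
  then have vw: "\<Phi> v v v w = 0"
    unfolding s D'[symmetric] using k by simp
  show False using z vp vu vw by (simp add: z_eq multilinear)
qed

text \<open>Restricted to a line missing \<open>p\<close>, parametrised by \<open>v \<mapsto> m\<close> with \<open>m = s p + v\<close>, the form \<open>D\<close> becomes
  \<open>(G - \<kappa> S) (G + \<kappa> S)\<close>, where \<open>G m = k s\<^sup>2 + 3 Q v\<close>, \<open>\<kappa>\<^sup>2 = k\<close> and \<open>S\<close> is a square root of the form.
  Here the first factor is \<open>c x y\<close>, and the coefficients of the second one are determined by \<open>c\<close>.\<close>
lemma missing_line_coeffs:
  assumes p: "homology_centre p" and u: "\<Phi> p p p u = 0" and w: "\<Phi> p p p w = 0"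
    and ind: "indep2 u w" and D: "9 * \<Phi> p p u u ^ 2 = \<Phi> p p p p * \<Phi> u u u u"
    and \<kappa>: "\<kappa> ^ 2 = \<Phi> p p p p"
    and m: "m = s *s p + u" and n: "n = t *s p + w"
    and S3: "4 * \<Phi> m m m n = 2 * Sm * \<Sigma>" and S2: "6 * \<Phi> m m n n = \<Sigma> ^ 2 + 2 * Sm * Sn"
    and S1: "4 * \<Phi> m n n n = 2 * \<Sigma> * Sn"
    and g: "\<Phi> p p p p * s ^ 2 + 3 * \<Phi> p p u u = \<kappa> * Sm"
      "\<Phi> p p p p * t ^ 2 + 3 * \<Phi> p p w w = \<kappa> * Sn"
    and c: "c = 2 * \<Phi> p p p p * s * t + 6 * \<Phi> p p u w - \<kappa> * \<Sigma>"
  shows "D31 p u w = 2 * c * (\<Phi> p p p p * s ^ 2 + 3 * \<Phi> p p u u)"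
    "D31 p w u = 2 * c * (\<Phi> p p p p * t ^ 2 + 3 * \<Phi> p p w w)"
    "c \<noteq> 0"
    "(c ^ 2 + D22 p u w - 12 * \<Phi> p p u w * c) ^ 2
       = 4 * (D31 p u w - 6 * \<Phi> p p u u * c) * (D31 p w u - 6 * \<Phi> p p w w * c)"
proof -
  define k where "k = \<Phi> p p p p"
  have e3: "\<Phi> m m m n = s ^ 3 * t * k + 3 * s ^ 2 * \<Phi> p p u w + 3 * s * t * \<Phi> p p u u + \<Phi> u u u w"
    unfolding m n centre_expand[OF p u u u w] k_def
    by (simp add: algebra_simps power2_eq_square power3_eq_cube)
  have e2: "\<Phi> m m n n = s ^ 2 * t ^ 2 * k + s ^ 2 * \<Phi> p p w w + 4 * s * t * \<Phi> p p u w
      + t ^ 2 * \<Phi> p p u u + \<Phi> u u w w"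
    unfolding m n centre_expand[OF p u u w w] k_def
    by (simp add: algebra_simps power2_eq_square power3_eq_cube)
  have e1: "\<Phi> m n n n = s * t ^ 3 * k + 3 * t ^ 2 * \<Phi> p p u w + 3 * s * t * \<Phi> p p w w + \<Phi> u w w w"
    unfolding m n centre_expand[OF p u w w w] k_def
    by (simp add: algebra_simps power2_eq_square power3_eq_cube)
  have sw: "\<Phi> w w w u = \<Phi> u w w w" "\<Phi> p p w u = \<Phi> p p u w" by (metis swaps)+
  \<comment> \<open>Multiplication by k = \<kappa>^2 turns \<open>S\<close> into \<kappa> S, whose
    outer coefficients are \<open>g1\<close>, \<open>g2\<close> and whose middle one is
    \<open>\<tau>\<close>.\<close>
  define \<tau> where "\<tau> = \<kappa> * \<Sigma>"
  define g1 g2 where "g1 = k * s ^ 2 + 3 * \<Phi> p p u u" and "g2 = k * t ^ 2 + 3 * \<Phi> p p w w"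
  have k3: "4 * k * \<Phi> m m m n = 2 * g1 * \<tau>"
  proof -
    have "4 * k * \<Phi> m m m n = k * (2 * Sm * \<Sigma>)" by (simp flip: S3)
    also have "\<dots> = \<kappa> ^ 2 * (2 * Sm * \<Sigma>)" by (simp add: \<kappa> k_def)
    also have "\<dots> = 2 * (\<kappa> * Sm) * \<tau>" by (simp add: \<tau>_def algebra_simps power2_eq_square)
    finally show ?thesis using g by (simp add: k_def g1_def)
  qed
  have k2: "6 * k * \<Phi> m m n n = \<tau> ^ 2 + 2 * g1 * g2"
  proof -
    have "6 * k * \<Phi> m m n n = k * (\<Sigma> ^ 2 + 2 * Sm * Sn)" by (simp flip: S2)
    also have "\<dots> = \<kappa> ^ 2 * (\<Sigma> ^ 2 + 2 * Sm * Sn)" by (simp add: \<kappa> k_def)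
    also have "\<dots> = \<tau> ^ 2 + 2 * (\<kappa> * Sm) * (\<kappa> * Sn)"
      by (simp add: \<tau>_def algebra_simps power2_eq_square)
    finally show ?thesis using g by (simp add: k_def g1_def g2_def)
  qed
  have k1: "4 * k * \<Phi> m n n n = 2 * g2 * \<tau>"
  proof -
    have "4 * k * \<Phi> m n n n = k * (2 * \<Sigma> * Sn)" by (simp flip: S1)
    also have "\<dots> = \<kappa> ^ 2 * (2 * \<Sigma> * Sn)" by (simp add: \<kappa> k_def)
    also have "\<dots> = 2 * (\<kappa> * Sn) * \<tau>" by (simp add: \<tau>_def algebra_simps power2_eq_square)
    finally show ?thesis using g by (simp add: k_def g2_def)
  qed
  \<comment> \<open>The middle coefficient of G on the line. Thus D = c x y (2 g1 x^2 + (2 \<gamma>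
    - c) x y + 2 g2 y^2), whose coefficients are read off next.\<close>
  define \<gamma> where "\<gamma> = 2 * k * s * t + 6 * \<Phi> p p u w"
  have c_eq: "c = \<gamma> - \<tau>" using c by (simp add: \<gamma>_def k_def \<tau>_def)
  have "D31 p u w = 2 * g1 * \<gamma> - 4 * k * \<Phi> m m m n"
    unfolding D31_def e3 g1_def \<gamma>_def k_def
    by (simp add: algebra_simps power2_eq_square power3_eq_cube)
  then have d31: "D31 p u w = 2 * c * g1" unfolding k3 c_eq by (simp add: algebra_simps)
  have "D31 p w u = 2 * g2 * \<gamma> - 4 * k * \<Phi> m n n n"
    unfolding D31_def e1 g2_def \<gamma>_def k_def sw
    by (simp add: algebra_simps power2_eq_square power3_eq_cube)
  then have d13: "D31 p w u = 2 * c * g2" unfolding k1 c_eq by (simp add: algebra_simps)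
  have "D22 p u w = \<gamma> ^ 2 + 2 * g1 * g2 - 6 * k * \<Phi> m m n n"
    unfolding D22_def e2 g1_def g2_def \<gamma>_def k_def
    by (simp add: algebra_simps power2_eq_square power3_eq_cube)
  then have d22: "D22 p u w = c * (2 * \<gamma> - c)"
    unfolding k2 c_eq by (simp add: algebra_simps power2_eq_square)
  show "D31 p u w = 2 * c * (\<Phi> p p p p * s ^ 2 + 3 * \<Phi> p p u u)"
    "D31 p w u = 2 * c * (\<Phi> p p p p * t ^ 2 + 3 * \<Phi> p p w w)"
    using d31 d13 by (simp_all add: g1_def g2_def k_def)
  show "c \<noteq> 0" using D31_nonzero[OF p u w ind D] d31 by auto
  \<comment> \<open>Elimination of \<open>s\<close> and \<open>t\<close>: both sides equal 16 c^2
    k^2 s^2 t^2.\<close>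
  show "(c ^ 2 + D22 p u w - 12 * \<Phi> p p u w * c) ^ 2
       = 4 * (D31 p u w - 6 * \<Phi> p p u u * c) * (D31 p w u - 6 * \<Phi> p p w w * c)"
    unfolding d31 d13 d22 g1_def g2_def \<gamma>_def
    by (simp add: algebra_simps power2_eq_square)
qed

section \<open>The resolvent quartic and the enumeration of the missing bitangents\<close>

definition resolvent :: "complex ^ 3 \<Rightarrow> complex ^ 3 \<Rightarrow> complex ^ 3 \<Rightarrow> complex poly" where
  "resolvent p u w =
    [: D22 p u w ^ 2 - 4 * D31 p u w * D31 p w u,
       24 * (D31 p u w * \<Phi> p p w w + D31 p w u * \<Phi> p p u u - D22 p u w * \<Phi> p p u w),
       2 * D22 p u w + 144 * \<Phi> p p u w ^ 2 - 144 * \<Phi> p p u u * \<Phi> p p w w,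
       - 24 * \<Phi> p p u w, 1 :]"

text \<open>The coefficients of \<open>resolvent\<close> arise by expanding the difference of these
  two sides in \<open>c\<close>; the result is monic of degree 4.\<close>

lemma resolvent_root:
  "poly (resolvent p u w) c = 0 \<longleftrightarrow>
    (c ^ 2 + D22 p u w - 12 * \<Phi> p p u w * c) ^ 2
       = 4 * (D31 p u w - 6 * \<Phi> p p u u * c) * (D31 p w u - 6 * \<Phi> p p w w * c)"
  unfolding resolvent_def by (simp add: algebra_simps power2_eq_square)

lemma resolvent_roots:
  "finite {c. poly (resolvent p u w) c = 0}" "card {c. poly (resolvent p u w) c = 0} \<le> 4"
proof -
  have nz: "resolvent p u w \<noteq> 0" and deg: "degree (resolvent p u w) = 4"
    by (simp_all add: resolvent_def)
  show "finite {c. poly (resolvent p u w) c = 0}" by (rule poly_roots_finite[OF nz])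
  show "card {c. poly (resolvent p u w) c = 0} \<le> 4" using card_poly_roots_bound[OF nz] deg by simp
qed

text \<open>Each zero \<open>v i\<close> of D lifts to a point of \<open>l\<close> where G -
  \<kappa> S or G + \<kappa> S vanishes. The zero \<open>v 0\<close> shares its factor with some
  \<open>v j\<close>; that factor is then c x y, with \<open>c\<close> a root of the resolvent, and
  \<open>c\<close> determines the squares of the heights \<open>s\<close>, \<open>t\<close> of the
  two lifted points.\<close>

lemma missing_bitangent:
  fixes v :: "nat \<Rightarrow> complex ^ 3"
  assumes p: "homology_centre p" and l: "bitangent_line l" "p \<notin> l"
    and h: "\<And>i. i < 4 \<Longrightarrow> \<Phi> p p p (v i) = 0"
    and D: "\<And>i. i < 4 \<Longrightarrow> 9 * \<Phi> p p (v i) (v i) ^ 2 = \<Phi> p p p p * \<Phi> (v i) (v i) (v i) (v i)"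
    and ind: "\<And>i j. i < 4 \<Longrightarrow> j < 4 \<Longrightarrow> i \<noteq> j \<Longrightarrow> indep2 (v i) (v j)"
  obtains j c s t where "j \<in> {1, 2, 3}" "poly (resolvent p (v 0) (v j)) c = 0"
    "s ^ 2 = (D31 p (v 0) (v j) / (2 * c) - 3 * \<Phi> p p (v 0) (v 0)) / \<Phi> p p p p"
    "t ^ 2 = (D31 p (v j) (v 0) / (2 * c) - 3 * \<Phi> p p (v j) (v j)) / \<Phi> p p p p"
    "l = vec.span {s *s p + v 0, t *s p + v j}"
proof -
  have k: "\<Phi> p p p p \<noteq> 0" using p by (simp add: homology_centre_def)
  have lp: "l \<in> proj_lines" using l(1) by (rule bitangent_lineD)
  then have sub: "vec.subspace l" by (simp add: proj_lines_def)
  obtain S \<Sigma> where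
    lin: "\<And>x y u w. S (x *s u + y *s w) = x ^ 2 * S u + x * y * \<Sigma> u w + y ^ 2 * S w" and
    S: "\<And>u. u \<in> l \<Longrightarrow> \<Phi> u u u u = S u ^ 2"
       "\<And>u w. u \<in> l \<Longrightarrow> w \<in> l \<Longrightarrow> 4 * \<Phi> u u u w = 2 * S u * \<Sigma> u w"
       "\<And>u w. u \<in> l \<Longrightarrow> w \<in> l \<Longrightarrow> 6 * \<Phi> u u w w = \<Sigma> u w ^ 2 + 2 * S u * S w"
       "\<And>u w. u \<in> l \<Longrightarrow> w \<in> l \<Longrightarrow> 4 * \<Phi> u w w w = 2 * \<Sigma> u w * S w"
    using bitangent_square[OF l(1)] by blast
  have "\<exists>s. s *s p + v i \<in> l" for i
    using proj_line_complement[OF lp l(2), of "v i"] by (metis add.commute)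
  then obtain s where sl: "\<And>i. s i *s p + v i \<in> l" by metis
  define m where "m i = s i *s p + v i" for i
  have ml: "m i \<in> l" for i using sl by (simp add: m_def)
  define g where "g i = \<Phi> p p p p * s i ^ 2 + 3 * \<Phi> p p (v i) (v i)" for i
  have g_sq: "g i ^ 2 = \<Phi> p p p p * S (m i) ^ 2" if i: "i < 4" for i
  proof -
    have "\<Phi> (m i) (m i) (m i) (m i) = s i ^ 4 * \<Phi> p p p p + 6 * s i ^ 2 * \<Phi> p p (v i) (v i)
        + \<Phi> (v i) (v i) (v i) (v i)"
      unfolding m_def centre_expand[OF p h[OF i] h[OF i] h[OF i] h[OF i]]
      by (simp add: algebra_simps power2_eq_square power4_eq_xxxx)
    then have "\<Phi> p p p p * S (m i) ^ 2 = \<Phi> p p p p * (s i ^ 4 * \<Phi> p p p p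
        + 6 * s i ^ 2 * \<Phi> p p (v i) (v i)) + 9 * \<Phi> p p (v i) (v i) ^ 2"
      using S(1)[OF ml] D[OF i] by (simp add: algebra_simps)
    then show ?thesis by (simp add: g_def algebra_simps power2_eq_square power4_eq_xxxx)
  qed
  \<comment> \<open>The sign of the square root is chosen so that \<open>v 0\<close> is a zero of
    the first factor.\<close>
  have "\<exists>\<kappa>. \<kappa> ^ 2 = \<Phi> p p p p \<and> g 0 = \<kappa> * S (m 0)"
  proof -
    define \<kappa> where "\<kappa> = csqrt (\<Phi> p p p p)"
    have "\<kappa> ^ 2 = \<Phi> p p p p" by (simp add: \<kappa>_def)
    moreover from this have "g 0 ^ 2 = (\<kappa> * S (m 0)) ^ 2" using g_sq[of 0] by (simp add: power_mult_distrib)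
    then have "g 0 = \<kappa> * S (m 0) \<or> g 0 = (- \<kappa>) * S (m 0)" by (simp add: power2_eq_iff)
    ultimately show ?thesis by (metis power2_minus)
  qed
  then obtain \<kappa> where \<kappa>: "\<kappa> ^ 2 = \<Phi> p p p p" and g0: "g 0 = \<kappa> * S (m 0)" by blast
  \<comment> \<open>Otherwise the quadratic form G + \<kappa> S would have the three zeros
    \<open>v 1\<close>, \<open>v 2\<close>, \<open>v 3\<close> and vanish identically, while its
    middle coefficient is nonzero by \<open>missing_line_coeffs\<close> applied to -
    \<kappa>.\<close>
  have "\<exists>j\<in>{1, 2, 3}. g j = \<kappa> * S (m j)"
  proof (rule ccontr)
    assume n: "\<not> ?thesis"
    have neg: "g i = (- \<kappa>) * S (m i)" if "i \<in> {1, 2, 3}" for i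
    proof -
      have "g i ^ 2 = (\<kappa> * S (m i)) ^ 2" using g_sq[of i] that \<kappa> by (auto simp: power_mult_distrib)
      then show ?thesis using n that by (auto simp: power2_eq_iff)
    qed
    obtain x y where v3: "v 3 = x *s v 1 + y *s v 2"
      using hyperplane_span[OF k h[of 1] h[of 2] ind[of 1 2] h[of 3]] by auto
    have x: "x \<noteq> 0"
    proof
      assume "x = 0"
      then have "1 *s v 3 + (- y) *s v 2 = 0" using v3 by simp
      then show False using indep2D[OF ind[of 3 2], of 1 "- y"] by auto
    qed
    have y: "y \<noteq> 0"
    proof
      assume "y = 0"
      then have "1 *s v 3 + (- x) *s v 1 = 0" using v3 by simp
      then show False using indep2D[OF ind[of 3 1], of 1 "- x"] by auto
    qed
    \<comment> \<open>Lifting to \<open>l\<close> along \<open>p\<close> is linear: the difference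
      of the two sides is a multiple of \<open>p\<close> in \<open>l\<close>, hence zero.\<close>
    have m3: "m 3 = x *s m 1 + y *s m 2"
    proof -
      define z where "z = s 3 - x * s 1 - y * s 2"
      have "m 3 - (x *s m 1 + y *s m 2) \<in> l"
        using sub ml by (intro vec.subspace_add vec.subspace_scale vec.subspace_diff) auto
      moreover have e: "m 3 - (x *s m 1 + y *s m 2) = z *s p"
        by (simp add: m_def v3 z_def vec_eq_iff algebra_simps)
      ultimately have zl: "z *s p \<in> l" by simp
      have "z = 0"
      proof (rule ccontr)
        assume "z \<noteq> 0"
        moreover have "(1 / z) *s (z *s p) \<in> l" using sub zl by (rule vec.subspace_scale)
        ultimately show False using l(2) by simp
      qed
      then show ?thesis using e by simp
    qed
    have s3: "s 3 = x * s 1 + y * s 2"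
    proof -
      have "\<Phi> p p p (m 3) = \<Phi> p p p (x *s m 1 + y *s m 2)" by (simp add: m3)
      then have "\<Phi> p p p p * s 3 = \<Phi> p p p p * (x * s 1 + y * s 2)"
        using h[of 1] h[of 2] h[of 3] by (simp add: m_def multilinear algebra_simps)
      then show ?thesis using k by simp
    qed
    define \<gamma> where "\<gamma> = 2 * \<Phi> p p p p * s 1 * s 2 + 6 * \<Phi> p p (v 1) (v 2)"
    have g3: "g 3 = x ^ 2 * g 1 + x * y * \<gamma> + y ^ 2 * g 2"
      unfolding g_def \<gamma>_def s3 v3 multilinear
      by (simp add: swaps) (simp add: algebra_simps power2_eq_square)
    have S3: "S (m 3) = x ^ 2 * S (m 1) + x * y * \<Sigma> (m 1) (m 2) + y ^ 2 * S (m 2)"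
      unfolding m3 by (rule lin)
    have "x * y * (\<gamma> + \<kappa> * \<Sigma> (m 1) (m 2)) = (g 3 + \<kappa> * S (m 3))
        - x ^ 2 * (g 1 + \<kappa> * S (m 1)) - y ^ 2 * (g 2 + \<kappa> * S (m 2))"
      unfolding g3 S3 by (simp add: algebra_simps)
    also have "\<dots> = 0" by (simp add: neg)
    finally have "x * y * (\<gamma> + \<kappa> * \<Sigma> (m 1) (m 2)) = 0" .
    then have "\<gamma> + \<kappa> * \<Sigma> (m 1) (m 2) = 0" using x y by simp
    moreover have "\<gamma> - (- \<kappa>) * \<Sigma> (m 1) (m 2) \<noteq> 0"
    proof (rule missing_line_coeffs(3))
      show "homology_centre p" by fact
      show "\<Phi> p p p (v 1) = 0" "\<Phi> p p p (v 2) = 0" "indep2 (v 1) (v 2)"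
        "9 * (\<Phi> p p (v 1) (v 1))\<^sup>2 = \<Phi> p p p p * \<Phi> (v 1) (v 1) (v 1) (v 1)"
        using h ind D by auto
      show "(- \<kappa>) ^ 2 = \<Phi> p p p p" using \<kappa> by simp
      show "m 1 = s 1 *s p + v 1" "m 2 = s 2 *s p + v 2" by (simp_all add: m_def)
      show "4 * \<Phi> (m 1) (m 1) (m 1) (m 2) = 2 * S (m 1) * \<Sigma> (m 1) (m 2)"
        "6 * \<Phi> (m 1) (m 1) (m 2) (m 2) = \<Sigma> (m 1) (m 2) ^ 2 + 2 * S (m 1) * S (m 2)"
        "4 * \<Phi> (m 1) (m 2) (m 2) (m 2) = 2 * \<Sigma> (m 1) (m 2) * S (m 2)"
        using S(2-4)[OF ml ml] by blast+
      show "\<Phi> p p p p * (s 1)\<^sup>2 + 3 * \<Phi> p p (v 1) (v 1) = - \<kappa> * S (m 1)"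
        "\<Phi> p p p p * (s 2)\<^sup>2 + 3 * \<Phi> p p (v 2) (v 2) = - \<kappa> * S (m 2)"
        using neg[of 1] neg[of 2] by (simp_all add: g_def)
      show "\<gamma> - - \<kappa> * \<Sigma> (m 1) (m 2) =
        2 * \<Phi> p p p p * s 1 * s 2 + 6 * \<Phi> p p (v 1) (v 2) - - \<kappa> * \<Sigma> (m 1) (m 2)"
        by (simp add: \<gamma>_def)
    qed
    ultimately show False by simp
  qed
  then obtain j where j: "j \<in> {1, 2, 3}" and gj: "g j = \<kappa> * S (m j)" by blast
  have j4: "0 < (4 :: nat)" "j < 4" "j \<noteq> 0" "0 \<noteq> j" using j by auto
  define c where "c = 2 * \<Phi> p p p p * s 0 * s j + 6 * \<Phi> p p (v 0) (v j) - \<kappa> * \<Sigma> (m 0) (m j)"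
  note mc = missing_line_coeffs[OF p h[OF j4(1)] h[OF j4(2)] ind[OF j4(1,2,4)] D[OF j4(1)] \<kappa>
      m_def[of 0] m_def[of j] S(2-4)[OF ml ml] g0[unfolded g_def] gj[unfolded g_def] c_def]
  show thesis
  proof (rule that[OF j])
    show "poly (resolvent p (v 0) (v j)) c = 0" unfolding resolvent_root by (rule mc(4))
    show "s 0 ^ 2 = (D31 p (v 0) (v j) / (2 * c) - 3 * \<Phi> p p (v 0) (v 0)) / \<Phi> p p p p"
      using mc(1,3) k by (simp add: field_simps)
    show "s j ^ 2 = (D31 p (v j) (v 0) / (2 * c) - 3 * \<Phi> p p (v j) (v j)) / \<Phi> p p p p"
      using mc(2,3) k by (simp add: field_simps)
    have "indep2 (m 0) (m j)" unfolding indep2_def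
    proof (intro allI impI)
      fix x y assume e: "x *s m 0 + y *s m j = 0"
      have "\<Phi> p p p (x *s m 0 + y *s m j) = 0" unfolding e by (rule zero)
      then have "\<Phi> p p p p * (x * s 0 + y * s j) = 0"
        using h[OF j4(1)] h[OF j4(2)] by (simp add: m_def multilinear algebra_simps)
      then have "x * s 0 + y * s j = 0" using k by simp
      moreover have "x *s m 0 + y *s m j = (x * s 0 + y * s j) *s p + (x *s v 0 + y *s v j)"
        by (simp add: m_def vec_eq_iff algebra_simps)
      ultimately show "x = 0 \<and> y = 0" using e indep2D[OF ind[OF j4(1,2,4)]] by simp
    qed
    then show "l = vec.span {s 0 *s p + v 0, s j *s p + v j}"
      using proj_line_eq_span[OF lp ml ml] by (simp add: m_def)
  qed
qed

lemma card_missing_bitangents: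
  fixes v :: "nat \<Rightarrow> complex ^ 3"
  assumes p: "homology_centre p"
    and h: "\<And>i. i < 4 \<Longrightarrow> \<Phi> p p p (v i) = 0"
    and D: "\<And>i. i < 4 \<Longrightarrow> 9 * \<Phi> p p (v i) (v i) ^ 2 = \<Phi> p p p p * \<Phi> (v i) (v i) (v i) (v i)"
    and ind: "\<And>i j. i < 4 \<Longrightarrow> j < 4 \<Longrightarrow> i \<noteq> j \<Longrightarrow> indep2 (v i) (v j)"
  defines "M \<equiv> {l. bitangent_line l \<and> p \<notin> l}"
  shows "finite M \<and> card M \<le> 48"
proof -
  \<comment> \<open>A root \<open>c = 0\<close> is harmless: the quotient is then 0 by convention,
    and the set still has at most two elements.\<close>
  define X where "X j c = {s. s ^ 2 = (D31 p (v 0) (v j) / (2 * c) - 3 * \<Phi> p p (v 0) (v 0)) / \<Phi> p p p p}" for j c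
  define Y where "Y j c = {t. t ^ 2 = (D31 p (v j) (v 0) / (2 * c) - 3 * \<Phi> p p (v j) (v j)) / \<Phi> p p p p}" for j c
  define R where "R j = {c. poly (resolvent p (v 0) (v j)) c = 0}" for j
  define L where "L j c = (\<lambda>(s, t). vec.span {s *s p + v 0, t *s p + v j}) ` (X j c \<times> Y j c)" for j c
  have fL: "finite (L j c)" and cL: "card (L j c) \<le> 4" for j c
  proof -
    have f: "finite (X j c \<times> Y j c)" using square_roots by (simp add: X_def Y_def)
    then show "finite (L j c)" by (simp add: L_def)
    have "card (X j c \<times> Y j c) \<le> 2 * 2"
      unfolding card_cartesian_product X_def Y_def by (intro mult_le_mono square_roots)
    then show "card (L j c) \<le> 4" unfolding L_def
      using card_image_le[OF f, of "\<lambda>(s, t). vec.span {s *s p + v 0, t *s p + v j}"] by linarith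
  qed
  have fU: "finite (\<Union>c\<in>R j. L j c)" and cU: "card (\<Union>c\<in>R j. L j c) \<le> 16" for j
  proof -
    have R: "finite (R j)" "card (R j) \<le> 4" unfolding R_def by (rule resolvent_roots)+
    show "finite (\<Union>c\<in>R j. L j c)" using R fL by auto
    have "card (\<Union>c\<in>R j. L j c) \<le> (\<Sum>c\<in>R j. card (L j c))" by (rule card_UN_le[OF R(1)])
    also have "\<dots> \<le> card (R j) * 4" using sum_bounded_above[of "R j" "\<lambda>c. card (L j c)" 4] cL by simp
    finally show "card (\<Union>c\<in>R j. L j c) \<le> 16" using R by simp
  qed
  have "M \<subseteq> (\<Union>j\<in>{1, 2, 3}. \<Union>c\<in>R j. L j c)"
  proof
    fix l assume "l \<in> M"
    then have l: "bitangent_line l" "p \<notin> l" by (auto simp: M_def)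
    show "l \<in> (\<Union>j\<in>{1, 2, 3}. \<Union>c\<in>R j. L j c)"
    proof (rule missing_bitangent[OF p l h D ind])
      fix j c s t
      assume a: "j \<in> {1, 2, 3}" "poly (resolvent p (v 0) (v j)) c = 0"
        "s ^ 2 = (D31 p (v 0) (v j) / (2 * c) - 3 * \<Phi> p p (v 0) (v 0)) / \<Phi> p p p p"
        "t ^ 2 = (D31 p (v j) (v 0) / (2 * c) - 3 * \<Phi> p p (v j) (v j)) / \<Phi> p p p p"
        "l = vec.span {s *s p + v 0, t *s p + v j}"
      have "c \<in> R j" "(s, t) \<in> X j c \<times> Y j c" using a(2-4) by (auto simp: R_def X_def Y_def)
      then have "l \<in> L j c" unfolding L_def a(5) by (metis (no_types, lifting) case_prod_conv image_eqI)
      then show ?thesis using a(1) \<open>c \<in> R j\<close> by blast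
    qed auto
  qed
  moreover have "finite (\<Union>j\<in>{1, 2, 3}. \<Union>c\<in>R j. L j c)" using fU by blast
  moreover have "card (\<Union>j\<in>{1, 2, 3}. \<Union>c\<in>R j. L j c) \<le> (\<Sum>j\<in>{1, 2, 3}. card (\<Union>c\<in>R j. L j c))"
    by (rule card_UN_le) simp
  moreover have "(\<Sum>j\<in>{1, 2, 3}. card (\<Union>c\<in>R j. L j c)) \<le> 48"
    using cU[of 1] cU[of 2] cU[of 3] by simp
  ultimately show ?thesis by (meson card_mono finite_subset order_trans)
qed

section \<open>Counting incidences\<close>

text \<open>The directions \<open>v i\<close> of the four lines serve twice: as zeros of the cubic
  they make \<open>p\<close> a centre, and as zeros of D they feed the count of the lines missing
  \<open>p\<close>.\<close>

lemma quadruple_point_centre: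
  assumes B: "\<And>l. l \<in> B \<Longrightarrow> bitangent_line l" and P: "P \<in> quadruple_points B"
  obtains p and v :: "nat \<Rightarrow> complex ^ 3" where "P = vec.span {p}" "homology_centre p"
    "\<And>i. i < 4 \<Longrightarrow> \<Phi> p p p (v i) = 0"
    "\<And>i. i < 4 \<Longrightarrow> 9 * \<Phi> p p (v i) (v i) ^ 2 = \<Phi> p p p p * \<Phi> (v i) (v i) (v i) (v i)"
    "\<And>i j. i < 4 \<Longrightarrow> j < 4 \<Longrightarrow> i \<noteq> j \<Longrightarrow> indep2 (v i) (v j)"
proof -
  have "P \<in> proj_points" and c: "card {l \<in> B. P \<subseteq> l} = 4"
    using P by (auto simp: quadruple_points_def)
  then obtain p where p0: "p \<noteq> 0" and Pp: "P = vec.span {p}" using proj_point_span by metis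
  \<comment> \<open>An infinite set has cardinality 0, so cardinality 4 yields finiteness.\<close>
  have "finite {l \<in> B. P \<subseteq> l}" using c by (intro card_ge_0_finite) simp
  then obtain f where f: "bij_betw f {0..<4 :: nat} {l \<in> B. P \<subseteq> l}"
    using ex_bij_betw_nat_finite c by metis
  have inj: "f i \<noteq> f j" if "i < 4" "j < 4" "i \<noteq> j" for i j
    using f that by (auto simp: bij_betw_def inj_on_def)
  have "f i \<in> {l \<in> B. P \<subseteq> l}" if "i < 4" for i
    using f that by (auto simp: bij_betw_def)
  then have bt: "bitangent_line (f i)" and pf: "p \<in> f i" if "i < 4" for i
    using B that vec.span_base[of p "{p}"] by (auto simp: Pp)
  have k: "\<Phi> p p p p \<noteq> 0"
    by (rule not_on_curve_if_two_bitangents[OF bt pf bt pf inj p0, of 0 1]) auto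
  have "\<exists>v. v \<in> f i \<and> v \<noteq> 0 \<and> \<Phi> p p p v = 0 \<and> f i = vec.span {p, v}" if "i < 4" for i
    using line_hyperplane[OF bitangent_lineD[OF bt[OF that]] pf[OF that] k] by metis
  then obtain v where v: "\<And>i. i < 4 \<Longrightarrow> v i \<in> f i" "\<And>i. i < 4 \<Longrightarrow> v i \<noteq> 0"
    "\<And>i. i < 4 \<Longrightarrow> \<Phi> p p p (v i) = 0" "\<And>i. i < 4 \<Longrightarrow> f i = vec.span {p, v i}" by metis
  have ind: "indep2 (v i) (v j)" if "i < 4" "j < 4" "i \<noteq> j" for i j
    using indep2_of_bitangents[OF v(4) v(4) bitangent_lineD[OF bt] bitangent_lineD[OF bt] inj v(2) v(2)]
      that by blast
  have cubic: "\<Phi> p (v i) (v i) (v i) = 0" if "i < 4" for i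
    by (rule bitangent_through(1)[OF bt pf v(1) k v(3)]) (rule that)+
  show thesis
  proof (rule that[OF Pp _ v(3) _ ind])
    show "homology_centre p" by (rule four_bitangents_homology_centre[OF k v(3) cubic ind])
    show "9 * \<Phi> p p (v i) (v i) ^ 2 = \<Phi> p p p p * \<Phi> (v i) (v i) (v i) (v i)" if "i < 4" for i
      by (rule bitangent_through(2)[OF bt pf v(1) k v(3)]) (rule that)+
  qed auto
qed

text \<open>Double counting of incidences. Finiteness of \<open>B\<close> is not assumed but follows
  from a single quadruple point, which is why the empty case is split off.\<close>

lemma card_quadruple_points:
  assumes B: "\<And>l. l \<in> B \<Longrightarrow> bitangent_line l"
  shows "finite (quadruple_points B) \<and> card (quadruple_points B) \<le> 39"
proof (cases "quadruple_points B = {}")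
  case False
  define R where "R = quadruple_points B"
  have centre: "\<exists>p. P = vec.span {p} \<and> homology_centre p" if "P \<in> R" for P
    using quadruple_point_centre[OF B that[unfolded R_def]] by metis
  have four: "card {l \<in> B. P \<subseteq> l} = 4" if "P \<in> R" for P
    using that by (simp add: R_def quadruple_points_def)
  obtain P where P: "P \<in> R" using False by (auto simp: R_def)
  obtain p and v :: "nat \<Rightarrow> complex ^ 3" where Pp: "P = vec.span {p}" and cf: "homology_centre p"
    "\<And>i. i < 4 \<Longrightarrow> \<Phi> p p p (v i) = 0"
    "\<And>i. i < 4 \<Longrightarrow> 9 * \<Phi> p p (v i) (v i) ^ 2 = \<Phi> p p p p * \<Phi> (v i) (v i) (v i) (v i)"
    "\<And>i j. i < 4 \<Longrightarrow> j < 4 \<Longrightarrow> i \<noteq> j \<Longrightarrow> indep2 (v i) (v j)"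
    using quadruple_point_centre[OF B P[unfolded R_def]] by metis
  define M where "M = {l. bitangent_line l \<and> p \<notin> l}"
  have M: "finite M" "card M \<le> 48" using card_missing_bitangents[OF cf] by (simp_all add: M_def)
  have T: "finite {l \<in> B. P \<subseteq> l}" using four[OF P] by (intro card_ge_0_finite) simp
  have "B \<subseteq> {l \<in> B. P \<subseteq> l} \<union> M"
    using B span_single_subset_iff[OF bitangent_lineD] by (auto simp: M_def Pp)
  then have finB: "finite B" and "card B \<le> card ({l \<in> B. P \<subseteq> l} \<union> M)"
    using M(1) T by (auto intro: finite_subset card_mono)
  then have cardB: "card B \<le> 52"
    using card_Un_le[of "{l \<in> B. P \<subseteq> l}" M] four[OF P] M(2) by linarith
  have three: "finite {P \<in> R. P \<subseteq> l} \<and> card {P \<in> R. P \<subseteq> l} \<le> 3" if l: "l \<in> B" for l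
  proof -
    have "{P \<in> R. P \<subseteq> l} \<subseteq> {vec.span {p} |p. p \<in> l \<and> homology_centre p}"
      using centre span_single_subset_iff[OF bitangent_lineD[OF B[OF l]]] by fastforce
    then show ?thesis using card_centres_on_bitangent[OF B[OF l]]
      by (meson card_mono finite_subset order_trans)
  qed
  have "R \<subseteq> (\<Union>l\<in>B. {P \<in> R. P \<subseteq> l})"
  proof
    fix P assume "P \<in> R"
    then have "{l \<in> B. P \<subseteq> l} \<noteq> {}" using four by (metis card.empty zero_neq_numeral)
    then show "P \<in> (\<Union>l\<in>B. {P \<in> R. P \<subseteq> l})" using \<open>P \<in> R\<close> by blast
  qed
  then have finR: "finite R" using finB three by (meson finite_UN_I finite_subset)
  have "4 * card R = (\<Sum>l\<in>B. card {P \<in> R. P \<subseteq> l})"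
    using sum_multicount[OF finB finR, of "\<lambda>l P. P \<subseteq> l" 4] four by auto
  also have "\<dots> \<le> card B * 3"
    using sum_bounded_above[of B "\<lambda>l. card {P \<in> R. P \<subseteq> l}" 3] three by simp
  finally show ?thesis using cardB finR by (simp add: R_def)
qed simp

end

section \<open>Polarisation of a quartic polynomial\<close>

text \<open>A property closed under sums and scaling, so that only monomials need an explicit
  polarisation.\<close>

definition polarisable :: "(complex ^ 3 \<Rightarrow> complex) \<Rightarrow> bool" where
  "polarisable f \<longleftrightarrow> (\<exists>\<Phi>. quartic_form \<Phi> \<and> (\<forall>v. f v = \<Phi> v v v v))"

lemma polarisable_zero: "polarisable (\<lambda>v. 0)"
  unfolding polarisable_def by (rule exI[of _ "\<lambda>a b c d. 0"]) (simp add: quartic_form_def)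

lemma polarisable_add:
  assumes "polarisable f" "polarisable g" shows "polarisable (\<lambda>v. f v + g v)"
proof -
  obtain \<Phi> \<Psi> where 1: "quartic_form \<Phi>" "\<And>v. f v = \<Phi> v v v v" and 2: "quartic_form \<Psi>" "\<And>v. g v = \<Psi> v v v v"
    using assms by (auto simp: polarisable_def)
  interpret \<Phi>: quartic_form \<Phi> by fact
  interpret \<Psi>: quartic_form \<Psi> by fact
  have "quartic_form (\<lambda>a b c d. \<Phi> a b c d + \<Psi> a b c d)"
    by unfold_locales (simp add: \<Phi>.add1 \<Psi>.add1 \<Phi>.scale1 \<Psi>.scale1 algebra_simps
        | simp add: \<Phi>.swaps \<Psi>.swaps)+
  then show ?thesis unfolding polarisable_def using 1(2) 2(2) by auto
qed

lemma polarisable_scale: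
  assumes "polarisable f" shows "polarisable (\<lambda>v. r * f v)"
proof -
  obtain \<Phi> where 1: "quartic_form \<Phi>" "\<And>v. f v = \<Phi> v v v v"
    using assms by (auto simp: polarisable_def)
  interpret \<Phi>: quartic_form \<Phi> by fact
  have "quartic_form (\<lambda>a b c d. r * \<Phi> a b c d)"
    by unfold_locales (simp add: \<Phi>.add1 \<Phi>.scale1 algebra_simps | simp add: \<Phi>.swaps)+
  then show ?thesis unfolding polarisable_def using 1(2) by auto
qed

lemma polarisable_sum:
  assumes "finite A" "\<And>x. x \<in> A \<Longrightarrow> polarisable (f x)"
  shows "polarisable (\<lambda>v. \<Sum>x\<in>A. f x v)"
  using assms by (induction A) (simp_all add: polarisable_zero polarisable_add)

text \<open>The first two and the last two factors are symmetrised to bilinear forms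
  \<open>p\<close> and \<open>q\<close>; averaging over the six ways to hand two of four arguments
  to \<open>p\<close> gives full symmetry.\<close>

lemma polarisable_product: "polarisable (\<lambda>v. v $ i * (v $ j * (v $ k * v $ l)))"
proof -
  define p where "p a b = (a $ i * b $ j + a $ j * b $ i) / 2" for a b :: "complex ^ 3"
  define q where "q a b = (a $ k * b $ l + a $ l * b $ k) / 2" for a b :: "complex ^ 3"
  have p: "p a b = p b a" "p (a + a') b = p a b + p a' b" "p (r *s a) b = r * p a b"
    and q: "q a b = q b a" "q (a + a') b = q a b + q a' b" "q (r *s a) b = r * q a b" for a a' b r
    by (simp_all add: p_def q_def algebra_simps add_divide_distrib)
  define \<Phi> where "\<Phi> a b c d = (p a b * q c d + p c d * q a b + p a c * q b d + p b d * q a c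
    + p a d * q b c + p b c * q a d) / 6" for a b c d
  have "quartic_form \<Phi>"
  proof
    fix a a' b c d r
    show "\<Phi> (a + a') b c d = \<Phi> a b c d + \<Phi> a' b c d"
      unfolding \<Phi>_def p(2) q(2) by (simp add: algebra_simps add_divide_distrib)
    show "\<Phi> (r *s a) b c d = r * \<Phi> a b c d"
      unfolding \<Phi>_def p(3) q(3) by (simp add: algebra_simps)
    show "\<Phi> a b c d = \<Phi> b a c d" by (simp add: \<Phi>_def p(1)[of b a] q(1)[of b a])
    show "\<Phi> a b c d = \<Phi> a c b d" by (simp add: \<Phi>_def p(1)[of c b] q(1)[of c b])
    show "\<Phi> a b c d = \<Phi> a b d c" by (simp add: \<Phi>_def p(1)[of d c] q(1)[of d c])
  qed
  moreover have "v $ i * (v $ j * (v $ k * v $ l)) = \<Phi> v v v v" for v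
    by (simp add: \<Phi>_def p_def q_def)
  ultimately show ?thesis unfolding polarisable_def by blast
qed

text \<open>Peels one variable off; four applications turn a monomial of degree 4 into a product of
  four coordinates.\<close>

lemma monomial_split:
  fixes m :: "3 \<Rightarrow> nat"
  assumes "sum m UNIV = Suc n"
  obtains i m' where "sum m' UNIV = n" "\<And>v :: complex ^ 3. (\<Prod>x\<in>UNIV. (v $ x) ^ m x) = v $ i * (\<Prod>x\<in>UNIV. (v $ x) ^ m' x)"
proof -
  obtain i where i: "m i \<noteq> 0" using assms by (metis nat.distinct(1) sum.neutral)
  define m' where "m' = m(i := m i - 1)"
  have rest: "sum m' (UNIV - {i}) = sum m (UNIV - {i})"
    "\<And>v :: complex ^ 3. (\<Prod>x\<in>UNIV - {i}. (v $ x) ^ m' x) = (\<Prod>x\<in>UNIV - {i}. (v $ x) ^ m x)"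
    by (auto simp: m'_def intro!: sum.cong prod.cong)
  show thesis
  proof (rule that)
    show "sum m' UNIV = n"
      using assms i rest(1) by (simp add: sum.remove[of UNIV i] m'_def)
    show "(\<Prod>x\<in>UNIV. (v $ x) ^ m x) = v $ i * (\<Prod>x\<in>UNIV. (v $ x) ^ m' x)" for v :: "complex ^ 3"
      using i rest(2)[of v] by (simp add: prod.remove[of UNIV i] m'_def power_eq_if[of "v $ i" "m i"])
  qed
qed

lemma polarisable_monomial:
  fixes m :: "3 \<Rightarrow> nat"
  assumes "sum m UNIV = 4"
  shows "polarisable (\<lambda>v. \<Prod>x\<in>UNIV. (v $ x) ^ m x)"
proof -
  have "sum m UNIV = Suc 3" using assms by simp
  then obtain i m1 where 1: "sum m1 UNIV = 3"
    "\<And>v :: complex ^ 3. (\<Prod>x\<in>UNIV. (v $ x) ^ m x) = v $ i * (\<Prod>x\<in>UNIV. (v $ x) ^ m1 x)"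
    using monomial_split by blast
  have "sum m1 UNIV = Suc 2" using 1 by simp
  then obtain j m2 where 2: "sum m2 UNIV = 2"
    "\<And>v :: complex ^ 3. (\<Prod>x\<in>UNIV. (v $ x) ^ m1 x) = v $ j * (\<Prod>x\<in>UNIV. (v $ x) ^ m2 x)"
    using monomial_split by blast
  have "sum m2 UNIV = Suc 1" using 2 by simp
  then obtain k m3 where 3: "sum m3 UNIV = 1"
    "\<And>v :: complex ^ 3. (\<Prod>x\<in>UNIV. (v $ x) ^ m2 x) = v $ k * (\<Prod>x\<in>UNIV. (v $ x) ^ m3 x)"
    using monomial_split by blast
  have "sum m3 UNIV = Suc 0" using 3 by simp
  then obtain l m4 where 4: "sum m4 UNIV = 0"
    "\<And>v :: complex ^ 3. (\<Prod>x\<in>UNIV. (v $ x) ^ m3 x) = v $ l * (\<Prod>x\<in>UNIV. (v $ x) ^ m4 x)"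
    using monomial_split by blast
  have "(\<Prod>x\<in>UNIV. (v $ x) ^ m4 x) = 1" for v :: "complex ^ 3" using 4(1) by simp
  then show ?thesis using polarisable_product by (simp add: 1(2) 2(2) 3(2) 4(2))
qed

lemma polarisable_eval_at:
  assumes "homogeneous 4 F" shows "polarisable (eval_at F)"
  unfolding eval_at_def
proof (intro polarisable_sum polarisable_scale polarisable_monomial)
  show "finite (Poly_Mapping.keys F)" by simp
  show "sum (Poly_Mapping.lookup m) UNIV = 4" if "m \<in> Poly_Mapping.keys F" for m
    using assms that by (simp add: homogeneous_def)
qed

section \<open>Partial derivatives, restrictions to lines and bitangents in polar form\<close>

lemma partial_at_polar:
  assumes "quartic_form \<Phi>" and eval: "\<And>v. eval_at F v = \<Phi> v v v v"
  shows "partial_at i F v = 4 * \<Phi> v v v (axis i 1)"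
proof -
  interpret quartic_form \<Phi> by fact
  define e :: "complex ^ 3" where "e = axis i 1"
  have mono: "(\<Prod>x\<in>UNIV. ((v + t *s e) $ x) ^ m x)
      = (v $ i + t) ^ m i * (\<Prod>x\<in>UNIV - {i}. (v $ x) ^ m x)" for t and m :: "3 \<Rightarrow> nat"
  proof -
    have "(\<Prod>x\<in>UNIV - {i}. ((v + t *s e) $ x) ^ m x) = (\<Prod>x\<in>UNIV - {i}. (v $ x) ^ m x)"
      by (rule prod.cong) (auto simp: e_def axis_def)
    then show ?thesis by (simp add: prod.remove[of UNIV i] e_def)
  qed
  \<comment> \<open>Both sides are the derivative at 0 along the coordinate direction
    \<open>e\<close>, computed once from the monomials and once from the polar form.\<close>
  have "((\<lambda>t. eval_at F (v + t *s e)) has_field_derivative partial_at i F v) (at 0)"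
    unfolding eval_at_def partial_at_def mono
    by (auto intro!: DERIV_sum derivative_eq_intros)
  moreover have "((\<lambda>t. eval_at F (v + t *s e)) has_field_derivative 4 * \<Phi> v v v e) (at 0)"
  proof -
    have "eval_at F (v + t *s e) = \<Phi> v v v v + 4 * t * \<Phi> v v v e + 6 * t ^ 2 * \<Phi> v v e e
        + 4 * t ^ 3 * \<Phi> v e e e + t ^ 4 * \<Phi> e e e e" for t
      using diag_line[of 1 v t e] by (simp add: eval)
    then show ?thesis by (auto intro!: derivative_eq_intros)
  qed
  ultimately show ?thesis unfolding e_def by (rule DERIV_unique)
qed

lemma restrict_to_line_polar:
  assumes "quartic_form \<Phi>" and eval: "\<And>v. eval_at F v = \<Phi> v v v v"
  shows "restrict_to_line F p q = [:\<Phi> p p p p, 4 * \<Phi> p p p q, 6 * \<Phi> p p q q, 4 * \<Phi> p q q q, \<Phi> q q q q:]"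
proof -
  interpret quartic_form \<Phi> by fact
  have "poly (restrict_to_line F p q) t = eval_at F (1 *s p + t *s q)" for t
    by (simp add: restrict_to_line_def eval_at_def poly_sum poly_prod)
  then have "poly (restrict_to_line F p q) t
      = poly [:\<Phi> p p p p, 4 * \<Phi> p p p q, 6 * \<Phi> p p q q, 4 * \<Phi> p q q q, \<Phi> q q q q:] t" for t
    unfolding eval diag_line
    by (simp add: algebra_simps power2_eq_square power3_eq_cube power4_eq_xxxx)
  then show ?thesis by (metis poly_eq_poly_eq_iff ext)
qed

text \<open>An order of vanishing kills all lower coefficients. A fourfold point kills four and
  leaves the top one; for two double points the expansions at \<open>a\<close> and at
  \<open>a'\<close> kill two each and leave the middle one, since the restriction is
  nonzero.\<close>

lemma (in quartic_form) bitangents_bitangent_line: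
  assumes eval: "\<And>v. eval_at F v = \<Phi> v v v v" and l: "l \<in> bitangents F"
  shows "bitangent_line l"
proof -
  have lp: "l \<in> proj_lines" using l by (simp add: bitangents_def)
  obtain P P' where "cuts_out_divisor F l {#P, P, P', P'#}" using l by (auto simp: bitangents_def)
  then have pts: "P \<in> proj_points" "P \<subseteq> l" "P' \<in> proj_points" "P' \<subseteq> l"
    and ord: "\<And>p q. vec.span {p, q} = l \<Longrightarrow> restrict_to_line F p q \<noteq> 0 \<and>
        Polynomial.order 0 (restrict_to_line F p q) = count {#P, P, P', P'#} (vec.span {p})"
    unfolding cuts_out_divisor_def by auto
  obtain a where a: "a \<noteq> 0" "P = vec.span {a}" using proj_point_span pts by metis
  obtain a' where a': "a' \<noteq> 0" "P' = vec.span {a'}" using proj_point_span pts by metis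
  have al: "a \<in> l" "a' \<in> l" using pts a a' by (simp_all add: span_single_subset_iff[OF lp])
  have coeff0: "\<forall>k<count {#P, P, P', P'#} (vec.span {p}). coeff (restrict_to_line F p q) k = 0"
    if "vec.span {p, q} = l" for p q
    using ord[OF that] monom_1_dvd_iff monom_1_dvd_iff' by (metis order_refl)
  note r = restrict_to_line_polar[OF quartic_form_axioms eval]
  have sw: "\<Phi> a' a' a' a = \<Phi> a a' a' a'" by (metis swaps)
  show ?thesis
  proof (cases "P = P'")
    case True
    obtain b where b: "b \<in> l" "indep2 a b" using proj_line_extend[OF lp al(1) a(1)] .
    have sp: "vec.span {a, b} = l" using proj_line_eq_span[OF lp al(1) b] by simp
    have "\<forall>k<4. coeff (restrict_to_line F a b) k = 0" using coeff0[OF sp] True a by simp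
    then have "\<Phi> a a a a = 0" "\<Phi> a a a b = 0" "\<Phi> a a b b = 0" "\<Phi> a b b b = 0"
      unfolding r by (auto simp: numeral_eq_Suc All_less_Suc)
    moreover from this have "\<Phi> b b b b \<noteq> 0" using ord[OF sp] unfolding r by auto
    ultimately show ?thesis unfolding bitangent_line_def using lp b(2) sp by blast
  next
    case False
    then have i: "indep2 a a'" using indep2_span_single a a' by auto
    have sp: "vec.span {a, a'} = l" using proj_line_eq_span[OF lp al i] by simp
    have sp': "vec.span {a', a} = l" using sp by (simp add: insert_commute)
    have "\<forall>k<2. coeff (restrict_to_line F a a') k = 0" using coeff0[OF sp] False a by simp
    moreover have "\<forall>k<2. coeff (restrict_to_line F a' a) k = 0" using coeff0[OF sp'] False a' by simp
    ultimately have z: "\<Phi> a a a a = 0" "\<Phi> a a a a' = 0" "\<Phi> a' a' a' a' = 0" "\<Phi> a a' a' a' = 0"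
      using sw unfolding r by (auto simp: numeral_eq_Suc All_less_Suc)
    moreover from this have "\<Phi> a a a' a' \<noteq> 0" using ord[OF sp] unfolding r by auto
    ultimately show ?thesis unfolding bitangent_line_def using lp i sp by blast
  qed
qed

theorem proposition3p4:
  fixes F :: ternary_poly
  assumes "smooth_plane_quartic F"
  shows "finite (quadruple_points (bitangents F)) \<and>
         card (quadruple_points (bitangents F)) \<le> 44"
proof -
  obtain \<Phi> where \<Phi>: "quartic_form \<Phi>" and eval: "\<And>v. eval_at F v = \<Phi> v v v v"
    using assms polarisable_eval_at unfolding smooth_plane_quartic_def polarisable_def by blast
  interpret quartic_form \<Phi> by fact
  interpret smooth_quartic_form \<Phi>
  proof
    fix v :: "complex ^ 3" assume v: "v \<noteq> 0"
    show "\<exists>w. \<Phi> v v v w \<noteq> 0"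
    \<comment> \<open>The hypothesis concerns only points of the curve; elsewhere \<open>v\<close>
      itself is the required direction.\<close>
    proof (cases "eval_at F v = 0")
      case True
      then obtain i where "partial_at i F v \<noteq> 0" using assms v by (auto simp: smooth_plane_quartic_def)
      then show ?thesis using partial_at_polar[OF \<Phi> eval] by auto
    qed (auto simp: eval)
  qed
  \<comment> \<open>The bound 39 from the incidence count implies the claim.\<close>
  show ?thesis using card_quadruple_points[of "bitangents F"] bitangents_bitangent_line[OF eval] by force
qed

end
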